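(* Let $m\ge 3$ be an integer. Then there does not exist a left-symmetric superalgebra on the simple Lie superalgebra $\mathfrak{sl}(m|1)$ over $\mathbb{C}$.
   Context: All vector spaces and algebras are over $\mathbb{C}$. A superalgebra is a $\mathbb{Z}_2$-graded vector space $\mathcal L=\mathcal L_{\bar 0}\oplus\mathcal L_{\bar 1}$ with a bilinear product satisfying $\mathcal L_{\gamma'}\cdot\mathcal L_{\gamma''}\subseteq\mathcal L_{\gamma'+\gamma''}$. It is a left-symmetric superalgebra (LSSA) if for all homogeneous $x,y,z\in\mathcal L$: $(x\cdot y)\cdot z-x\cdot(y\cdot z)=(-1)^{|x||y|}\big((y\cdot x)\cdot z-y\cdot(x\cdot z)\big)$. The supercommutator $[x,y]=x\cdot y-(-1)^{|x||y|}y\cdot x$ (for homogeneous $x,y$) then makes $\mathcal L$ a Lie superalgebra. An LSSA on a Lie superalgebra $\mathfrak g$ is an LSSA product on the $\mathbb{Z}_2$-graded vector space $\mathfrak g$ whose supercommutator equals the given bracket of $\mathfrak g$. $\mathfrak{gl}(m|n)$ is the space of $(m+n)\times(m+n)$ complex matrices $X=\begin{pmatrix} X_1 & X_2 \\ X_3 & X_4 \end{pmatrix}$ with blocks of sizes $m\times m$, $m\times n$, $n\times m$, $n\times n$; the even part is $X_2=X_3=0$, the odd part is $X_1=X_4=0$, and the bracket is $[X,Y]=XY-(-1)^{|X||Y|}YX$. $\mathfrak{sl}(m|n)=\{X\in\mathfrak{gl}(m|n): \mathrm{tr}(X_1)-\mathrm{tr}(X_4)=0\}$. *)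

theory Defs
  imports "HOL-Analysis.Analysis" "HOL-Library.Z2"
begin

section \<open>Superalgebras\<close>

text \<open>
  The group of parities is the two-element field \<open>bit\<close>, so that \<open>p + q\<close> is addition
  modulo 2 and \<open>koszul p q\<close> is the sign \<open>(-1)\<^sup>p\<^sup>q\<close>.  The underlying space of an algebra
  is a subspace \<open>L\<close> of an ambient complex vector space, with homogeneous components \<open>V 0\<close> and
  \<open>V 1\<close>; products are only constrained on \<open>L\<close>.  The zero vector is homogeneous of both
  parities, which is why identities range over a parity together with an element of it.
\<close>

definition koszul :: "bit \<Rightarrow> bit \<Rightarrow> complex"
  where "koszul p q = (if p = 1 \<and> q = 1 then - 1 else 1)"

locale super_space = vector_space scale
  for scale :: "complex \<Rightarrow> 'a::ab_group_add \<Rightarrow> 'a" +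
  fixes L :: "'a set" and V :: "bit \<Rightarrow> 'a set"
  assumes subspace_component: "subspace (V p)"
    and sum_components: "L = {x + y | x y. x \<in> V 0 \<and> y \<in> V 1}"
    and direct_components: "V 0 \<inter> V 1 = {0}"

locale superalgebra = super_space scale L V
  for scale :: "complex \<Rightarrow> 'a::ab_group_add \<Rightarrow> 'a" and L V +
  fixes mult :: "'a \<Rightarrow> 'a \<Rightarrow> 'a"
  assumes mult_add_left:
      "\<lbrakk>x \<in> L; y \<in> L; z \<in> L\<rbrakk> \<Longrightarrow> mult (x + y) z = mult x z + mult y z"
    and mult_add_right:
      "\<lbrakk>x \<in> L; y \<in> L; z \<in> L\<rbrakk> \<Longrightarrow> mult x (y + z) = mult x y + mult x z"
    and mult_scale_left:
      "\<lbrakk>x \<in> L; y \<in> L\<rbrakk> \<Longrightarrow> mult (scale c x) y = scale c (mult x y)"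
    and mult_scale_right:
      "\<lbrakk>x \<in> L; y \<in> L\<rbrakk> \<Longrightarrow> mult x (scale c y) = scale c (mult x y)"
    and mult_graded:
      "\<lbrakk>x \<in> V p; y \<in> V q\<rbrakk> \<Longrightarrow> mult x y \<in> V (p + q)"

locale lie_superalgebra = superalgebra scale L V bracket
  for scale :: "complex \<Rightarrow> 'a::ab_group_add \<Rightarrow> 'a" and L V bracket +
  assumes super_skew:
      "\<lbrakk>x \<in> V p; y \<in> V q\<rbrakk> \<Longrightarrow> bracket x y = - scale (koszul p q) (bracket y x)"
    and super_jacobi:
      "\<lbrakk>x \<in> V p; y \<in> V q; z \<in> V r\<rbrakk> \<Longrightarrow>
        bracket x (bracket y z) =
        bracket (bracket x y) z + scale (koszul p q) (bracket y (bracket x z))"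

locale lssa = superalgebra scale L V mult
  for scale :: "complex \<Rightarrow> 'a::ab_group_add \<Rightarrow> 'a" and L V mult +
  assumes left_symmetric:
      "\<lbrakk>x \<in> V p; y \<in> V q; z \<in> V r\<rbrakk> \<Longrightarrow>
        mult (mult x y) z - mult x (mult y z) =
        scale (koszul p q) (mult (mult y x) z - mult y (mult x z))"

text \<open>
  It is not required separately that \<open>bracket\<close> be a Lie superbracket: supercommutators of
  left-symmetric superalgebras always are, and for \<open>sl(m|n)\<close> this is verified below.  By
  bilinearity it suffices to compare the two brackets on homogeneous elements.
\<close>

locale lssa_on = lssa scale L V mult
  for scale :: "complex \<Rightarrow> 'a::ab_group_add \<Rightarrow> 'a" and L V bracket mult +
  assumes supercommutator_eq_bracket:
      "\<lbrakk>x \<in> V p; y \<in> V q\<rbrakk> \<Longrightarrow> mult x y - scale (koszul p q) (mult y x) = bracket x y"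

section \<open>The Lie superalgebras \<open>gl(m|n)\<close> and \<open>sl(m|n)\<close>\<close>

text \<open>
  Rows and columns are indexed by the disjoint sum \<open>'m + 'n\<close> of two finite types with
  \<open>CARD('m) = m\<close> and \<open>CARD('n) = n\<close>.
\<close>

type_synonym ('m, 'n) supermatrix = "complex ^ ('m + 'n) ^ ('m + 'n)"

definition cscale :: "complex \<Rightarrow> complex ^ 'k ^ 'l \<Rightarrow> complex ^ 'k ^ 'l"
  where "cscale c X = (\<chi> i j. c * X $ i $ j)"

definition block1 :: "('m::finite, 'n::finite) supermatrix \<Rightarrow> complex ^ 'm ^ 'm"
  where "block1 X = (\<chi> i j. X $ Inl i $ Inl j)"

definition block2 :: "('m::finite, 'n::finite) supermatrix \<Rightarrow> complex ^ 'n ^ 'm"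
  where "block2 X = (\<chi> i j. X $ Inl i $ Inr j)"

definition block3 :: "('m::finite, 'n::finite) supermatrix \<Rightarrow> complex ^ 'm ^ 'n"
  where "block3 X = (\<chi> i j. X $ Inr i $ Inl j)"

definition block4 :: "('m::finite, 'n::finite) supermatrix \<Rightarrow> complex ^ 'n ^ 'n"
  where "block4 X = (\<chi> i j. X $ Inr i $ Inr j)"

definition gl_part :: "bit \<Rightarrow> ('m::finite, 'n::finite) supermatrix set"
  where "gl_part p =
    (if p = 0 then {X. block2 X = 0 \<and> block3 X = 0} else {X. block1 X = 0 \<and> block4 X = 0})"

definition component :: "bit \<Rightarrow> ('m::finite, 'n::finite) supermatrix \<Rightarrow> ('m, 'n) supermatrix"
  where "component p X = (\<chi> i j. if (isl i = isl j) = (p = 0) then X $ i $ j else 0)"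

text \<open>
  The bracket is the bilinear extension of \<open>XY - (-1)\<^sup>p\<^sup>q YX\<close> from homogeneous matrices of
  parities \<open>p\<close> and \<open>q\<close>; see \<open>super_bracket_homogeneous\<close>.
\<close>

definition super_bracket ::
  "('m::finite, 'n::finite) supermatrix \<Rightarrow> ('m, 'n) supermatrix \<Rightarrow> ('m, 'n) supermatrix"
  where "super_bracket X Y =
    (\<Sum>p\<in>{0, 1}. \<Sum>q\<in>{0, 1}. component p X ** component q Y
       - cscale (koszul p q) (component q Y ** component p X))"

definition sl :: "('m::finite, 'n::finite) supermatrix set"
  where "sl = {X. trace (block1 X) - trace (block4 X) = 0}"

definition sl_part :: "bit \<Rightarrow> ('m::finite, 'n::finite) supermatrix set"
  where "sl_part p = sl \<inter> gl_part p"

lemma gl_part_iff: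
  "X \<in> gl_part p \<longleftrightarrow> (\<forall>i j. (isl i = isl j) \<noteq> (p = 0) \<longrightarrow> X $ i $ j = 0)"
proof -
  have all_sum: "(\<forall>i. P i) \<longleftrightarrow> (\<forall>a. P (Inl a)) \<and> (\<forall>b. P (Inr b))" for P :: "'a + 'b \<Rightarrow> bool"
    by (metis sum.exhaust)
  show ?thesis
    by (cases p) (auto simp: gl_part_def block1_def block2_def block3_def block4_def vec_eq_iff all_sum)
qed

lemma component_in: "component p X \<in> gl_part p"
  by (auto simp: gl_part_iff component_def)

lemma component_sum: "component 0 X + component 1 X = X"
  by (auto simp: component_def vec_eq_iff)

lemma component_homogeneous:
  assumes "X \<in> gl_part p"
  shows "component q X = (if q = p then X else 0)"
  using assms by (cases p; cases q) (auto simp: gl_part_iff component_def vec_eq_iff)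

lemma cscale_simps [simp]:
  "cscale 1 X = X" "cscale (- 1) X = - X" "cscale c 0 = 0" "cscale 0 X = 0"
  by (simp_all add: cscale_def vec_eq_iff)

lemma super_bracket_homogeneous:
  assumes "X \<in> gl_part p" "Y \<in> gl_part q"
  shows "super_bracket X Y = X ** Y - cscale (koszul p q) (Y ** X)"
  unfolding super_bracket_def component_homogeneous[OF assms(1)] component_homogeneous[OF assms(2)]
  by (cases p; cases q) simp_all

text \<open>
  The results below show that \<open>sl\<close> with \<open>super_bracket\<close> is indeed a Lie superalgebra, so that
  the non-existence of a left-symmetric product is not an artefact of the definitions.
\<close>

lemma vector_space_cscale: "vector_space cscale"
  by unfold_locales (auto simp: cscale_def vec_eq_iff algebra_simps)

lemma cscale_mult:
  fixes A :: "complex ^ 'k::finite ^ 'l::finite" and B :: "complex ^ 'o::finite ^ 'k"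
  shows "cscale c A ** B = cscale c (A ** B)" "A ** cscale c B = cscale c (A ** B)"
  by (simp_all add: cscale_def vec_eq_iff matrix_matrix_mult_def sum_distrib_left mult_ac)

lemma matrix_mult_linear:
  fixes A B :: "complex ^ 'k::finite ^ 'l::finite" and C D :: "complex ^ 'o::finite ^ 'k"
  shows "(A + B) ** C = A ** C + B ** C" "(A - B) ** C = A ** C - B ** C"
    "A ** (C - D) = A ** C - A ** D"
    "(- A) ** C = - (A ** C)" "A ** (- C) = - (A ** C)"
  by (simp_all add: vec_eq_iff matrix_matrix_mult_def sum_subtractf sum_negf sum.distrib
      algebra_simps)

lemma component_add: "component p (X + Y) = component p X + component p Y"
  unfolding component_def vec_eq_iff by (simp del: bit_not_zero_iff bit_not_one_iff)

lemma component_cscale: "component p (cscale c X) = cscale c (component p X)"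
  unfolding component_def cscale_def vec_eq_iff by (simp del: bit_not_zero_iff bit_not_one_iff)

lemma cscale_add: "cscale c (X + Y) = cscale c X + cscale c Y"
  and cscale_diff: "cscale c (X - Y) = cscale c X - cscale c Y"
  and cscale_cscale: "cscale c (cscale d X) = cscale (c * d) X"
  by (simp_all add: cscale_def vec_eq_iff algebra_simps)

lemma super_bracket_add:
  "super_bracket (X + Y) Z = super_bracket X Z + super_bracket Y Z"
  "super_bracket Z (X + Y) = super_bracket Z X + super_bracket Z Y"
  by (simp_all add: super_bracket_def component_add matrix_add_ldistrib matrix_mult_linear(1)
      cscale_add sum.distrib algebra_simps)

lemma super_bracket_cscale:
  "super_bracket (cscale c X) Y = cscale c (super_bracket X Y)"
  "super_bracket X (cscale c Y) = cscale c (super_bracket X Y)"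
  by (simp_all add: super_bracket_def component_cscale cscale_mult cscale_add cscale_diff
      cscale_cscale mult.commute)

lemma gl_part_mult:
  assumes "X \<in> gl_part p" "Y \<in> gl_part q"
  shows "X ** Y \<in> gl_part (p + q)"
  unfolding gl_part_iff
proof (intro allI impI)
  fix i j :: "'a + 'b"
  assume "(isl i = isl j) \<noteq> (p + q = 0)"
  then have "X $ i $ k = 0 \<or> Y $ k $ j = 0" for k
    using assms unfolding gl_part_iff
    by (cases p; cases q; cases "isl i"; cases "isl j"; cases "isl k") auto
  then show "(X ** Y) $ i $ j = 0"
    by (auto simp: matrix_matrix_mult_def intro!: sum.neutral)
qed

lemma gl_part_linear:
  assumes "X \<in> gl_part p" "Y \<in> gl_part p"
  shows "X + Y \<in> gl_part p" "X - Y \<in> gl_part p"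
  using assms by (auto simp: gl_part_iff)

lemma gl_part_cscale: "X \<in> gl_part p \<Longrightarrow> cscale c X \<in> gl_part p"
  by (auto simp: gl_part_iff cscale_def)

lemma super_bracket_gl_part:
  assumes "X \<in> gl_part p" "Y \<in> gl_part q"
  shows "super_bracket X Y \<in> gl_part (p + q)"
  using gl_part_mult[OF assms] gl_part_mult[OF assms(2,1)]
  unfolding super_bracket_homogeneous[OF assms] add.commute[of q p]
  by (intro gl_part_linear gl_part_cscale)

definition parity_sign :: "'m + 'n \<Rightarrow> complex"
  where "parity_sign i = (if isl i then 1 else - 1)"

lemma sl_iff: "X \<in> sl \<longleftrightarrow> (\<Sum>i\<in>UNIV. parity_sign i * X $ i $ i) = 0"
  by (simp add: sl_def trace_def block1_def block4_def parity_sign_def sum_negf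
      flip: UNIV_Plus_UNIV add: sum.Plus)

lemma sl_add: "X \<in> sl \<Longrightarrow> Y \<in> sl \<Longrightarrow> X + Y \<in> sl"
  by (simp add: sl_iff distrib_left sum.distrib)

lemma sl_cscale:
  assumes "X \<in> sl"
  shows "cscale c X \<in> sl"
proof -
  have "(\<Sum>i\<in>UNIV. parity_sign i * cscale c X $ i $ i) =
      c * (\<Sum>i\<in>UNIV. parity_sign i * X $ i $ i)"
    by (simp add: cscale_def sum_distrib_left mult_ac)
  then show ?thesis
    using assms by (simp add: sl_iff)
qed

lemma super_bracket_sl:
  assumes "X \<in> gl_part p" "Y \<in> gl_part q"
  shows "super_bracket X Y \<in> sl"
proof -
  have eq: "parity_sign i * (X $ i $ j * Y $ j $ i) =
      koszul p q * (parity_sign j * (Y $ j $ i * X $ i $ j))" for i j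
    using assms unfolding gl_part_iff
    by (cases p; cases q; cases "isl i"; cases "isl j")
      (auto simp: koszul_def parity_sign_def)
  have "(\<Sum>i\<in>UNIV. parity_sign i * (X ** Y) $ i $ i) =
      (\<Sum>i\<in>UNIV. \<Sum>j\<in>UNIV. parity_sign i * (X $ i $ j * Y $ j $ i))"
    by (simp add: matrix_matrix_mult_def sum_distrib_left)
  also have "\<dots> = (\<Sum>j\<in>UNIV. \<Sum>i\<in>UNIV. parity_sign i * (X $ i $ j * Y $ j $ i))"
    by (rule sum.swap)
  also have "\<dots> = (\<Sum>j\<in>UNIV. parity_sign j * cscale (koszul p q) (Y ** X) $ j $ j)"
    by (simp add: eq matrix_matrix_mult_def cscale_def sum_distrib_left mult_ac)
  finally show ?thesis
    by (simp add: sl_iff super_bracket_homogeneous[OF assms] right_diff_distrib sum_subtractf)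
qed

lemma component_sl:
  assumes "X \<in> sl"
  shows "component p X \<in> sl"
  using assms by (cases p) (simp_all add: sl_iff component_def)

lemma sl_components: "sl = {X + Y | X Y. X \<in> sl_part 0 \<and> Y \<in> sl_part 1}"
proof (intro equalityI subsetI)
  fix X :: "('a, 'b) supermatrix"
  assume "X \<in> sl"
  then show "X \<in> {X + Y | X Y. X \<in> sl_part 0 \<and> Y \<in> sl_part 1}"
    unfolding sl_part_def mem_Collect_eq
    by (intro exI[of _ "component 0 X"] exI[of _ "component 1 X"])
      (simp add: component_sum component_sl component_in)
qed (auto simp: sl_part_def sl_add)

theorem lie_superalgebra_sl:
  "lie_superalgebra cscale (sl :: ('m::finite, 'n::finite) supermatrix set) sl_part super_bracket"
proof -
  interpret vector_space "cscale :: complex \<Rightarrow> ('m, 'n) supermatrix \<Rightarrow> ('m, 'n) supermatrix"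
    by (rule vector_space_cscale)
  show ?thesis
  proof unfold_locales
    show "subspace (sl_part p)" for p
    proof (rule subspaceI)
      show "0 \<in> sl_part p"
        by (simp add: sl_part_def sl_iff gl_part_iff)
    qed (simp_all add: sl_part_def sl_add sl_cscale gl_part_linear gl_part_cscale)
    show "sl_part 0 \<inter> sl_part 1 = {0 :: ('m, 'n) supermatrix}"
    proof (intro equalityI subsetI)
      fix X :: "('m, 'n) supermatrix"
      assume "X \<in> sl_part 0 \<inter> sl_part 1"
      then have "X $ i $ j = 0" for i j
        by (cases "isl i = isl j") (auto simp: sl_part_def gl_part_iff)
      then show "X \<in> {0}"
        by (simp add: vec_eq_iff)
    qed (auto simp: sl_part_def sl_iff gl_part_iff)
  next
    fix X Y :: "('m, 'n) supermatrix" and p q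
    assume "X \<in> sl_part p" "Y \<in> sl_part q"
    then have XY: "X \<in> gl_part p" "Y \<in> gl_part q"
      by (auto simp: sl_part_def)
    then show "super_bracket X Y \<in> sl_part (p + q)"
      unfolding sl_part_def by (intro IntI super_bracket_sl[OF XY] super_bracket_gl_part)
    show "super_bracket X Y = - cscale (koszul p q) (super_bracket Y X)"
      by (simp add: super_bracket_homogeneous[OF XY] super_bracket_homogeneous[OF XY(2,1)] koszul_def)
  next
    fix X Y Z :: "('m, 'n) supermatrix" and p q r
    assume "X \<in> sl_part p" "Y \<in> sl_part q" "Z \<in> sl_part r"
    then have *: "X \<in> gl_part p" "Y \<in> gl_part q" "Z \<in> gl_part r"
      by (auto simp: sl_part_def)
    note hom = super_bracket_homogeneous
    have "super_bracket X (super_bracket Y Z) =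
        X ** super_bracket Y Z - cscale (koszul p (q + r)) (super_bracket Y Z ** X)"
      and "super_bracket (super_bracket X Y) Z =
        super_bracket X Y ** Z - cscale (koszul (p + q) r) (Z ** super_bracket X Y)"
      and "super_bracket Y (super_bracket X Z) =
        Y ** super_bracket X Z - cscale (koszul q (p + r)) (super_bracket X Z ** Y)"
      by (rule hom[OF *(1) super_bracket_gl_part[OF *(2,3)]]
          hom[OF super_bracket_gl_part[OF *(1,2)] *(3)]
          hom[OF *(2) super_bracket_gl_part[OF *(1,3)]])+
    then show "super_bracket X (super_bracket Y Z) = super_bracket (super_bracket X Y) Z +
        cscale (koszul p q) (super_bracket Y (super_bracket X Z))"
      unfolding hom[OF *(1,2)] hom[OF *(2,3)] hom[OF *(1,3)]
      by (cases p; cases q; cases r)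
        (simp_all add: koszul_def matrix_mult_linear matrix_add_ldistrib matrix_mul_assoc)
  qed (rule sl_components super_bracket_add super_bracket_cscale)+
qed

end

theory Submission
  imports "Jordan_Normal_Form.Schur_Decomposition" Defs
begin

text \<open>
  Let \<open>L\<close> and \<open>R\<close> be left and right multiplication by elements of the even part \<open>gl(m)\<close>.  The
  supertrace of every \<open>R x\<close> vanishes, because those of \<open>L x\<close> and \<open>ad x\<close> do, and
  \<open>[L x, R y] = R (x y) - R y R x\<close> then gives \<open>str ((R y)\<^sup>k) = 0\<close> for all \<open>k \<ge> 1\<close>.  So the nonzero
  eigenvalues of \<open>R y\<close> on the even part agree, with multiplicities, with those on the odd part,
  and there are at most \<open>2m\<close> of them.

  As in the proof of Whitehead's first lemma, there is an even \<open>u\<close> for which \<open>R u\<close> acts on the even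
  part as the Casimir operator \<open>C\<close> of \<open>sl(m)\<close> built from the operators \<open>L x\<close>.  Let \<open>P\<close> be the
  projection onto the generalized kernel of \<open>C\<close>; its rank is at least \<open>m\<^sup>2 - 2m \<ge> 3\<close>.  On its range
  the trace form of \<open>sl(m)\<close> vanishes, and since \<open>sl\<^sub>2\<close>-weights are real this forces \<open>sl(m)\<close> to act
  trivially there.  Hence \<open>P [x, y] = P (L x y) - P (L y x) = 0\<close> for \<open>x\<close>, \<open>y\<close> in \<open>sl(m)\<close>, so
  \<open>P\<close> kills a hyperplane and has rank at most 1, a contradiction.
\<close>

section \<open>Triangularization and polynomials in a complex matrix\<close>

no_notation vec_index (infixl "$" 100)
hide_const (open) Matrix.mat Matrix.vec Matrix.transpose_mat
hide_fact (open) Matrix.vec_eq_iff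

text \<open>Multiplication and powers in the type class sense are componentwise on \<open>complex^'n^'n\<close>.\<close>

primrec mpow :: "complex^'n::finite^'n \<Rightarrow> nat \<Rightarrow> complex^'n^'n" where
  "mpow A 0 = mat 1"
| "mpow A (Suc k) = A ** mpow A k"

section \<open>Schur triangularization, transported from numbered indices to a finite index
  type\<close>

definition of_jnf :: "('n \<Rightarrow> nat) \<Rightarrow> complex Matrix.mat \<Rightarrow> complex^'n^'n" where
  "of_jnf h M = (\<chi> i j. M $$ (h i, h j))"

lemma of_jnf_mult:
  fixes h :: "'n::finite \<Rightarrow> nat"
  assumes h: "bij_betw h UNIV {0..<n}" and M: "M \<in> carrier_mat n n" "N \<in> carrier_mat n n"
  shows "of_jnf h (M * N) = of_jnf h M ** of_jnf h N"
proof -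
  have "h i < n" for i using bij_betwE[OF h] by auto
  then have "(M * N) $$ (h i, h j) = (\<Sum>k\<in>UNIV. M $$ (h i, h k) * N $$ (h k, h j))" for i j
    using M sum.reindex_bij_betw[OF h, of "\<lambda>k. M $$ (h i, k) * N $$ (k, h j)"]
    by (simp add: scalar_prod_def)
  then show ?thesis
    by (simp add: of_jnf_def matrix_matrix_mult_def vec_eq_iff)
qed

lemma of_jnf_one:
  assumes "bij_betw h UNIV {0..<n}"
  shows "of_jnf h (1\<^sub>m n) = mat 1"
proof -
  have "h i < n" for i using bij_betwE[OF assms] by auto
  moreover have "h i = h j \<longleftrightarrow> i = j" for i j
    using assms by (auto simp: bij_betw_def inj_on_def)
  ultimately show ?thesis
    by (simp add: of_jnf_def mat_def vec_eq_iff)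
qed

text \<open>Over the complex numbers the characteristic polynomial splits, so a Schur decomposition
  exists. It is carried over along an enumeration \<open>h\<close> of the index type; triangularity
  refers to the order that \<open>h\<close> induces.\<close>

lemma schur_triangularization:
  fixes A :: "complex^'n::finite^'n"
  obtains h :: "'n \<Rightarrow> nat" and P Q T where "inj h" "A = P ** T ** Q" "P ** Q = mat 1" "Q ** P = mat 1"
    "\<And>i j. h j < h i \<Longrightarrow> T $ i $ j = 0" "\<And>i. h i < CARD('n)"
    "\<And>i. \<exists>v. v \<noteq> 0 \<and> A *v v = T $ i $ i *s v"
proof -
  define n where "n = CARD('n)"
  obtain g where g: "bij_betw g {0..<n} (UNIV :: 'n set)"
    using ex_bij_betw_nat_finite[of "UNIV::'n set"] n_def by auto
  define h where "h = inv_into {0..<n} g"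
  have h: "bij_betw h UNIV {0..<n}"
    unfolding h_def by (rule bij_betw_inv_into[OF g])
  have hg: "h (g a) = a" if "a < n" for a
    using that g by (simp add: h_def bij_betw_def)
  have gh: "g (h i) = i" for i
    using g unfolding h_def by (metis UNIV_I bij_betw_inv_into_right)
  have hn: "h i < n" for i using bij_betwE[OF h] by auto
  define J where "J = Matrix.mat n n (\<lambda>(a, b). A $ g a $ g b)"
  have J: "J \<in> carrier_mat n n" by (simp add: J_def)
  have AJ: "A = of_jnf h J" by (simp add: of_jnf_def J_def vec_eq_iff hn gh)
  obtain es where es: "char_poly J = (\<Prod>a\<leftarrow>es. [:- a, 1:])" "length es = n"
    using char_poly_factorized[OF J] by blast
  obtain B P Q where d: "schur_decomposition J es = (B, P, Q)"
    by (metis prod_cases3)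
  note sd = schur_decomposition[OF J es(1) d]
  note wit = similar_mat_witD2[OF J sd[THEN conjunct1]]
  \<comment> \<open>The diagonal entries of \<open>B\<close> are the roots \<open>es\<close> of the
    characteristic polynomial, hence eigenvalues.\<close>
  have ev: "\<exists>v. v \<noteq> 0 \<and> A *v v = of_jnf h B $ i $ i *s v" for i
  proof -
    have "B $$ (h i, h i) \<in> set es"
      using sd wit hn[of i] by (auto simp: diag_mat_def)
    then have "poly (char_poly J) (B $$ (h i, h i)) = 0"
      unfolding es by (induct es) auto
    then have "eigenvalue J (B $$ (h i, h i))"
      using eigenvalue_root_char_poly[OF J] by blast
    then obtain v where v: "v \<in> carrier_vec n" "v \<noteq> 0\<^sub>v n"
        "J *\<^sub>v v = B $$ (h i, h i) \<cdot>\<^sub>v v"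
      using J unfolding eigenvalue_def eigenvector_def by auto
    define w :: "complex^'n" where "w = (\<chi> k. vec_index v (h k))"
    have "w \<noteq> 0"
    proof
      assume "w = 0"
      then have "vec_index v (h k) = 0" for k by (simp add: w_def vec_eq_iff)
      then have "vec_index v a = 0" if "a < n" for a using hg[OF that] by metis
      with v(1,2) show False by (auto simp: vec_eq_iff)
    qed
    moreover have "A *v w = of_jnf h B $ i $ i *s w"
    proof -
      have "(A *v w) $ k = vec_index (J *\<^sub>v v) (h k)" for k
        using v(1) J hn sum.reindex_bij_betw[OF h, of "\<lambda>l. J $$ (h k, l) * vec_index v l"]
        by (simp add: AJ of_jnf_def w_def matrix_vector_mult_def scalar_prod_def)
      with v(1) hn show ?thesis
        by (simp add: v(3) of_jnf_def w_def Finite_Cartesian_Product.vec_eq_iff)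
    qed
    ultimately show ?thesis by blast
  qed
  show ?thesis
  proof (rule that)
    show "inj h" using h by (simp add: bij_betw_def)
    show "A = of_jnf h P ** of_jnf h B ** of_jnf h Q"
      using wit AJ by (simp add: of_jnf_mult[OF h, symmetric])
    show "of_jnf h P ** of_jnf h Q = mat 1" "of_jnf h Q ** of_jnf h P = mat 1"
      using wit by (simp_all add: of_jnf_mult[OF h, symmetric] of_jnf_one[OF h])
    show "of_jnf h B $ i $ j = 0" if "h j < h i" for i j
      using sd wit hn that by (auto simp: of_jnf_def)
  qed (use ev hn n_def in auto)
qed

section \<open>Polynomials in a matrix\<close>

lemma mpow_commute: "A ** mpow A k = mpow A k ** A"
  by (induct k) (simp_all add: matrix_mul_assoc)

lemma trace_cscale: "trace (cscale c A) = c * trace A"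
  by (simp add: trace_def cscale_def sum_distrib_left)

text \<open>Horner's scheme for the product \<open>**\<close>; the class multiplication, on which
  \<open>poly\<close> relies, is entrywise.\<close>

definition mpeval :: "complex poly \<Rightarrow> complex^'n::finite^'n \<Rightarrow> complex^'n^'n" where
  "mpeval p A = fold_coeffs (\<lambda>a M. cscale a (mat 1) + A ** M) p 0"

lemma mpeval_0 [simp]: "mpeval 0 A = 0"
  by (simp add: mpeval_def)

lemma mpeval_pCons [simp]: "mpeval (pCons a p) A = cscale a (mat 1) + A ** mpeval p A"
  by (cases "a = 0"; cases "p = 0") (simp_all add: mpeval_def)

lemma mpeval_1 [simp]: "mpeval 1 A = mat 1"
  by (simp add: one_pCons)

lemma mpeval_add:
  fixes A :: "complex^'a::finite^'a"
  shows "mpeval (p + q) A = mpeval p A + mpeval q A"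
proof (induct p q rule: poly_induct2)
  case (pCons a p b q)
  have "cscale (a + b) (mat 1) = cscale a (mat 1) + (cscale b (mat 1) :: complex^'a^'a)"
    by (simp add: cscale_def vec_eq_iff algebra_simps)
  with pCons show ?case
    by (simp add: matrix_add_ldistrib)
qed simp

lemma mpeval_smult: "mpeval (Polynomial.smult c p) A = cscale c (mpeval p A)"
  by (induct p) (simp_all add: cscale_add cscale_mult cscale_cscale)

lemma mpeval_mult: "mpeval (p * q) A = mpeval p A ** mpeval q A"
  by (induct p)
    (simp_all add: mpeval_add mpeval_smult matrix_mult_linear(1) cscale_mult matrix_mul_assoc)

lemma mpeval_diff: "mpeval (p - q) A = mpeval p A - mpeval q A"
  using mpeval_add[of p "- q" A] mpeval_smult[of "-1" q A] by simp

lemma mpeval_power: "mpeval (p ^ k) A = mpow (mpeval p A) k"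
  by (induct k) (simp_all add: mpeval_mult)

lemma mpeval_commute:
  assumes "X ** A = A ** X"
  shows "X ** mpeval p A = mpeval p A ** X"
  by (induct p)
    (simp_all add: matrix_add_ldistrib matrix_mult_linear(1) cscale_mult matrix_mul_assoc assms,
     metis assms matrix_mul_assoc)

lemma cscale_vector_mult: "cscale c A *v w = c *s (A *v w)"
  by (simp add: cscale_def matrix_vector_mult_def vec_eq_iff sum_distrib_left mult.assoc)

lemma mpeval_eigenvector:
  assumes "A *v v = c *s v"
  shows "mpeval p A *v v = poly p c *s v"
proof (induct p)
  case (pCons a p)
  with pCons assms show ?case
    by (simp add: matrix_vector_mult_add_rdistrib matrix_vector_mul_assoc[symmetric]
        cscale_vector_mult vec.scale vector_sadd_rdistrib mult.commute)
qed simp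

lemma mpeval_similar:
  assumes "Q ** P = mat 1" "P ** Q = mat 1"
  shows "mpeval p (P ** T ** Q) = P ** mpeval p T ** Q"
proof (induct p)
  case (pCons a p)
  have "P ** T ** Q ** (P ** mpeval p T ** Q) = P ** T ** (Q ** P) ** mpeval p T ** Q"
    by (simp add: matrix_mul_assoc)
  with pCons assms show ?case
    by (simp add: matrix_add_ldistrib matrix_mult_linear(1) cscale_mult matrix_mul_assoc)
qed simp

text \<open>Both claims are proved in one induction: the diagonal entry of the product collapses to
  one term because the second factor is already known to be triangular.\<close>

lemma mpeval_triangular:
  fixes h :: "'n::finite \<Rightarrow> nat"
  assumes "inj h" and T: "\<And>i j. h j < h i \<Longrightarrow> T $ i $ j = 0"
  shows "(h j < h i \<longrightarrow> mpeval p T $ i $ j = 0) \<and> mpeval p T $ i $ i = poly p (T $ i $ i)"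
proof (induct p arbitrary: i j)
  case (pCons a p)
  have "(T ** mpeval p T) $ i $ j = 0" if "h j < h i" for i j
  proof -
    have "T $ i $ k * mpeval p T $ k $ j = 0" for k
      using T[of k i] pCons(2)[of j k] that by (cases "h k < h i") auto
    then show ?thesis
      by (simp add: matrix_matrix_mult_def)
  qed
  moreover have "(T ** mpeval p T) $ i $ i = T $ i $ i * poly p (T $ i $ i)"
  proof -
    have "T $ i $ k * mpeval p T $ k $ i = (if k = i then T $ i $ i * poly p (T $ i $ i) else 0)" for k
      using T[of k i] pCons(2)[of i k] pCons(2)[of k i] injD[OF assms(1), of k i]
      by (cases "h k < h i"; cases "h i < h k") auto
    then show ?thesis
      by (simp add: matrix_matrix_mult_def)
  qed
  ultimately show ?case
    by (auto simp: cscale_def mat_def)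
qed simp

text \<open>Each factor \<open>S\<close> raises the position \<open>h\<close> by at least one, and
  all positions lie below \<open>CARD('n)\<close>.\<close>

lemma strictly_triangular_nilpotent:
  fixes h :: "'n::finite \<Rightarrow> nat"
  assumes h: "\<And>i. h i < CARD('n)" and S: "\<And>i j. h j \<le> h i \<Longrightarrow> S $ i $ j = 0"
  shows "mpow S (CARD('n)) = 0"
proof -
  have *: "mpow S k $ i $ j = 0" if "h j < h i + k" for i j k
    using that
  proof (induct k arbitrary: i j)
    case (Suc k)
    have "S $ i $ l * mpow S k $ l $ j = 0" for l
      using S[of l i] Suc(1)[of j l] Suc(2) by (cases "h l \<le> h i") auto
    then show ?case
      by (simp add: matrix_matrix_mult_def)
  qed (auto simp: mat_def)
  show ?thesis
    using h by (auto simp: vec_eq_iff intro!: * trans_less_add2)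
qed

text \<open>\<open>es\<close> is the diagonal of a Schur form. The third property takes the place of
  the Cayley-Hamilton theorem: if \<open>p\<close> vanishes on the diagonal, then \<open>p\<close>
  of the triangular form is strictly triangular, hence nilpotent.\<close>

lemma spectrum:
  fixes A :: "complex^'n::finite^'n"
  obtains es :: "'n \<Rightarrow> complex" where
    "\<And>p. trace (mpeval p A) = (\<Sum>i\<in>UNIV. poly p (es i))"
    "\<And>i. \<exists>v. v \<noteq> 0 \<and> A *v v = es i *s v"
    "\<And>p. (\<And>i. poly p (es i) = 0) \<Longrightarrow> mpeval (p ^ CARD('n)) A = 0"
proof (rule schur_triangularization[of A])
  fix h :: "'n \<Rightarrow> nat" and P Q T
  assume h: "inj h" and A: "A = P ** T ** Q" and PQ: "P ** Q = mat 1" "Q ** P = mat 1"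
    and T: "\<And>i j. h j < h i \<Longrightarrow> T $ i $ j = 0" and hn: "\<And>i. h i < CARD('n)"
    and ev: "\<And>i. \<exists>v. v \<noteq> 0 \<and> A *v v = T $ i $ i *s v"
  note tri = mpeval_triangular[OF h T]
  note sim = mpeval_similar[OF PQ(2,1), of _ T, folded A]
  show ?thesis
  proof (rule that[of "\<lambda>i. T $ i $ i"])
    fix p
    have "trace (mpeval p A) = trace (Q ** (P ** mpeval p T))"
      unfolding sim by (rule trace_mul_sym)
    then show "trace (mpeval p A) = (\<Sum>i\<in>UNIV. poly p (T $ i $ i))"
      by (simp add: matrix_mul_assoc PQ trace_def tri)
  next
    fix p assume p: "\<And>i. poly p (T $ i $ i) = 0"
    have "mpow (mpeval p T) (CARD('n)) = 0"
    proof (rule strictly_triangular_nilpotent[OF hn])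
      fix i j assume "h j \<le> h i"
      then show "mpeval p T $ i $ j = 0"
        using tri[of j i p] p injD[OF h, of i j] by (cases "i = j") auto
    qed
    then show "mpeval (p ^ CARD('n)) A = 0"
      by (simp add: sim mpeval_power)
  qed (rule ev)
qed

section \<open>Traces of powers and the projection onto the generalized kernel\<close>

text \<open>Without its constant term, \<open>p\<close> is a combination of positive powers, whose
  traces agree. The constant term contributes \<open>poly p 0\<close> times the size of the
  matrix.\<close>

lemma trace_mpeval_eq:
  fixes A :: "complex^'n::finite^'n" and B :: "complex^'k::finite^'k"
  assumes "\<And>k. trace (mpow A (Suc k)) = trace (mpow B (Suc k))"
  shows "trace (mpeval p A) - of_nat CARD('n) * poly p 0 = trace (mpeval p B) - of_nat CARD('k) * poly p 0"
proof -
  \<comment> \<open>A positive power is kept in front so that the induction can absorb the variable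
    of \<open>pCons a p\<close> into it.\<close>
  have *: "trace (mpow A (Suc k) ** mpeval p A) = trace (mpow B (Suc k) ** mpeval p B)" for k p
  proof (induct p arbitrary: k)
    case (pCons a p)
    have "mpow A (Suc k) ** (A ** mpeval p A) = mpow A (Suc (Suc k)) ** mpeval p A"
      "mpow B (Suc k) ** (B ** mpeval p B) = mpow B (Suc (Suc k)) ** mpeval p B"
      by (simp_all add: matrix_mul_assoc mpow_commute)
    then show ?case
      using pCons(2)[of "Suc k"] assms[of k]
      by (simp only: mpeval_pCons matrix_add_ldistrib cscale_mult matrix_mul_rid trace_add trace_cscale)
  qed (simp add: trace_def)
  show ?thesis
  proof (cases p)
    case (pCons a q)
    show ?thesis
      using *[of 0 q] by (simp add: pCons trace_add trace_cscale trace_I)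
  qed
qed

text \<open>\<open>mpeval f A\<close> projects onto the generalized kernel of \<open>A\<close>. Its
  trace is found through \<open>B\<close>: since \<open>f\<close> is 1 at 0 and 0 at the nonzero
  eigenvalues of both matrices, the trace of \<open>mpeval f B\<close> is the number
  \<open>j\<close> of zeros among the eigenvalues of \<open>B\<close>, and
  \<open>trace_mpeval_eq\<close> transfers this to \<open>A\<close>.\<close>

lemma fitting_projection:
  fixes A :: "complex^'n::finite^'n" and B :: "complex^'k::finite^'k"
  assumes "\<And>k. trace (mpow A (Suc k)) = trace (mpow B (Suc k))"
  obtains f j where "mpeval f A ** mpeval f A = mpeval f A" "trace (mpeval f A ** A) = 0"
    "trace (mpeval f A) = of_nat CARD('n) - of_nat CARD('k) + of_nat j"
proof (rule spectrum[of A]; rule spectrum[of B])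
  fix a :: "'n \<Rightarrow> complex" and b :: "'k \<Rightarrow> complex"
  assume a: "\<And>p. trace (mpeval p A) = (\<Sum>i\<in>UNIV. poly p (a i))"
    "\<And>p. (\<And>i. poly p (a i) = 0) \<Longrightarrow> mpeval (p ^ CARD('n)) A = 0"
    and b: "\<And>p. trace (mpeval p B) = (\<Sum>i\<in>UNIV. poly p (b i))"
  define n where "n = CARD('n)"
  define S where "S = range a \<union> range b - {0}"
  define r where "r = (\<Prod>c\<in>S. [:1, - 1 / c:])"
  \<comment> \<open>\<open>f \<equiv> 1\<close> modulo \<open>X\<^sup>n\<close> and \<open>f \<equiv> 0\<close> modulo \<open>r\<^sup>n\<close>, so \<open>f(A)\<close> projects onto the generalized kernel\<close>
  define f where "f = 1 - (1 - r ^ n) ^ n"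
  have n: "n > 0" by (simp add: n_def)
  have r0: "poly r 0 = 1" by (simp add: r_def poly_prod)
  have rS: "poly r c = 0" if "c \<in> S" for c
    using that by (auto simp: r_def poly_prod S_def)
  have f0: "poly f 0 = 1" using n by (simp add: f_def r0 zero_power)
  have fS: "poly f c = 0" if "c \<in> S" for c
    using that n by (simp add: f_def rS zero_power)
  have "r ^ n dvd f"
    using one_diff_power_eq[of "1 - r ^ n" n] by (simp add: f_def)
  moreover have "[:0, 1:] ^ n dvd 1 - f"
    using r0 by (simp add: f_def dvd_power_same poly_eq_0_iff_dvd[of _ 0, simplified, symmetric])
  ultimately have "([:0, 1:] * r) ^ n dvd (1 - f) * f"
    unfolding power_mult_distrib by (rule mult_dvd_mono[rotated])
  then obtain q where q: "(1 - f) * f = ([:0, 1:] * r) ^ n * q" by (auto elim: dvdE)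
  \<comment> \<open>\<open>[:0, 1:] * r\<close> vanishes at every eigenvalue of \<open>A\<close>, so
    its \<open>n\<close>-th power annihilates \<open>A\<close>; with the divisibility above this
    yields idempotence.\<close>
  have "mpeval (([:0, 1:] * r) ^ n) A = 0"
    unfolding n_def
  proof (rule a(2))
    show "poly ([:0, 1:] * r) (a i) = 0" for i
      using rS[of "a i"] by (auto simp: S_def)
  qed
  then have "mpeval ((1 - f) * f) A = 0"
    by (simp add: q mpeval_mult)
  then have idem: "mpeval f A ** mpeval f A = mpeval f A"
    by (simp add: mpeval_mult mpeval_diff matrix_mult_linear)
  have "mpeval f A ** A = mpeval (f * [:0, 1:]) A"
    by (simp add: mpeval_mult mpeval_commute[of A A, OF refl])
  moreover have "poly (f * [:0, 1:]) (a i) = 0" for i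
    using fS[of "a i"] by (auto simp: S_def)
  ultimately have tr: "trace (mpeval f A ** A) = 0"
    by (simp add: a(1) del: mult_pCons_right)
  have "poly f (b i) = (if b i = 0 then 1 else 0)" for i
    using fS[of "b i"] f0 by (auto simp: S_def)
  then have "trace (mpeval f B) = of_nat (card {i. b i = 0})"
    by (simp add: b sum.If_cases)
  with trace_mpeval_eq[OF assms, of f] f0
  have "trace (mpeval f A) = of_nat CARD('n) - of_nat CARD('k) + of_nat (card {i. b i = 0})"
    by (simp add: algebra_simps)
  from that[OF idem tr this] show ?thesis .
qed

section \<open>The Casimir operator of a representation of \<open>gl(m)\<close>\<close>

text \<open>An eigenvector is raised by \<open>e\<close> to a highest weight vector
  \<open>w\<close>, which \<open>f\<close> then lowers until it vanishes. This forces the highest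
  weight to be a natural number, and \<open>c\<close> differs from it by an even integer.\<close>

lemma sl2_eigenvalue_real:
  fixes h e f :: "complex^'n::finite^'n"
  assumes he: "h ** e - e ** h = cscale 2 e" and hf: "h ** f - f ** h = cscale (- 2) f"
    and ef: "e ** f - f ** e = h"
    and v: "v \<noteq> 0" "h *v v = c *s v"
  shows "c \<in> \<real>"
proof -
  \<comment> \<open>Some power of the polynomial with roots \<open>es\<close> annihilates
    \<open>h\<close>, so every eigenvalue is some \<open>es i\<close>. Finiteness makes both the
    raising and the lowering chain stop.\<close>
  have fin: "finite {c. \<exists>v. v \<noteq> 0 \<and> h *v v = c *s v}"
  proof (rule spectrum[of h])
    fix es :: "'n \<Rightarrow> complex"
    assume es: "\<And>p. (\<And>i. poly p (es i) = 0) \<Longrightarrow> mpeval (p ^ CARD('n)) h = 0"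
    define p where "p = (\<Prod>i\<in>UNIV. [:- es i, 1:])"
    have "mpeval (p ^ CARD('n)) h = 0"
      by (rule es) (auto simp: p_def poly_prod)
    then have "poly p c = 0" if "v \<noteq> 0" "h *v v = c *s v" for c v
      using mpeval_eigenvector[OF that(2), of "p ^ CARD('n)"] that(1) by simp
    then have "\<exists>i. c = es i" if "v \<noteq> 0" "h *v v = c *s v" for c v
      using that by (auto simp: p_def poly_prod)
    then have "{c. \<exists>v. v \<noteq> 0 \<and> h *v v = c *s v} \<subseteq> range es"
      by blast
    then show ?thesis
      by (rule finite_subset) simp
  qed
  have he': "h *v (e *v w) = (d + 2) *s (e *v w)" if "h *v w = d *s w" for d w
  proof -
    have "h *v (e *v w) = (h ** e) *v w"
      by (simp add: matrix_vector_mul_assoc)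
    also have "h ** e = e ** h + cscale 2 e"
      using he by (simp add: diff_eq_eq add.commute)
    also have "\<dots> *v w = e *v (h *v w) + 2 *s (e *v w)"
      by (simp only: matrix_vector_mult_add_rdistrib matrix_vector_mul_assoc cscale_vector_mult)
    finally show ?thesis
      by (simp add: that vec.scale vector_sadd_rdistrib)
  qed
  have hf': "h *v (f *v w) = (d - 2) *s (f *v w)" if "h *v w = d *s w" for d w
  proof -
    have "h *v (f *v w) = (h ** f) *v w"
      by (simp add: matrix_vector_mul_assoc)
    also have "h ** f = f ** h + cscale (- 2) f"
      using hf by (simp add: diff_eq_eq add.commute)
    also have "\<dots> *v w = f *v (h *v w) + (- 2) *s (f *v w)"
      by (simp only: matrix_vector_mult_add_rdistrib matrix_vector_mul_assoc cscale_vector_mult)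
    also have "\<dots> = (d + - 2) *s (f *v w)"
      by (simp only: that vec.scale vector_sadd_rdistrib)
    finally show ?thesis
      by simp
  qed
  have ef': "e *v (f *v w) = f *v (e *v w) + h *v w" for w
  proof -
    have "e ** f = f ** e + h"
      using ef by (simp add: diff_eq_eq add.commute)
    then show ?thesis
      by (simp add: matrix_vector_mul_assoc matrix_vector_mult_add_rdistrib)
  qed
  define E where "E k = ((*v) e ^^ k) v" for k
  have E: "h *v E k = (c + 2 * of_nat k) *s E k" for k
  proof (induct k)
    case (Suc k)
    then show ?case
      using he'[OF Suc] by (simp add: E_def add.assoc distrib_left)
  qed (simp add: E_def v)
  have "\<exists>k. E k = 0"
  proof (rule ccontr)
    assume "\<nexists>k. E k = 0"
    then have "range (\<lambda>k. c + 2 * of_nat k) \<subseteq> {c. \<exists>v. v \<noteq> 0 \<and> h *v v = c *s v}"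
      using E by blast
    moreover have "inj (\<lambda>k. c + 2 * of_nat k)"
      by (auto simp: inj_on_def)
    ultimately show False
      using fin finite_subset range_inj_infinite by blast
  qed
  then obtain k where k: "E k = 0" "\<And>i. i < k \<Longrightarrow> E i \<noteq> 0"
    using exists_least_iff[of "\<lambda>k. E k = 0"] by auto
  \<comment> \<open>\<open>E k'\<close> is the last nonzero vector of the raising chain;
    \<open>k\<close> is positive because \<open>E 0 = v\<close>.\<close>
  with v(1) obtain k' where k': "k = Suc k'"
    by (cases k) (auto simp: E_def)
  define w where "w = E k'"
  define \<mu> where "\<mu> = c + 2 * of_nat k'"
  have w: "w \<noteq> 0" "h *v w = \<mu> *s w" "e *v w = 0"
    using k k' E[of k'] by (auto simp: w_def \<mu>_def E_def)
  define F where "F j = ((*v) f ^^ j) w" for j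
  have F: "h *v F j = (\<mu> - 2 * of_nat j) *s F j" for j
  proof (induct j)
    case (Suc j)
    then show ?case
      using hf'[OF Suc] by (simp add: F_def diff_diff_eq distrib_left)
  qed (simp add: F_def w)
  have "\<exists>k. F k = 0"
  proof (rule ccontr)
    assume "\<nexists>k. F k = 0"
    then have "range (\<lambda>k. \<mu> - 2 * of_nat k) \<subseteq> {c. \<exists>v. v \<noteq> 0 \<and> h *v v = c *s v}"
      using F by blast
    moreover have "inj (\<lambda>k. \<mu> - 2 * of_nat k)"
      by (auto simp: inj_on_def)
    ultimately show False
      using fin finite_subset range_inj_infinite by blast
  qed
  then obtain j where j: "F j = 0" "\<And>i. i < j \<Longrightarrow> F i \<noteq> 0"
    using exists_least_iff[of "\<lambda>k. F k = 0"] by auto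
  with w(1) obtain j' where j': "j = Suc j'"
    by (cases j) (auto simp: F_def)
  \<comment> \<open>At the last nonzero vector \<open>F j'\<close> the left side vanishes, which
    leaves \<open>\<mu> = of_nat j'\<close>.\<close>
  have eF: "e *v F (Suc i) = (of_nat (Suc i) * (\<mu> - of_nat i)) *s F i" for i
  proof (induct i)
    case 0
    show ?case
      using ef'[of w] w by (simp add: F_def)
  next
    case (Suc i)
    have "e *v F (Suc (Suc i)) = f *v (e *v F (Suc i)) + h *v F (Suc i)"
      using ef'[of "F (Suc i)"] by (simp add: F_def)
    also have "\<dots> = (of_nat (Suc i) * (\<mu> - of_nat i)) *s F (Suc i) + (\<mu> - 2 * of_nat (Suc i)) *s F (Suc i)"
      unfolding Suc F vec.scale by (simp add: F_def)
    also have "\<dots> = (of_nat (Suc i) * (\<mu> - of_nat i) + (\<mu> - 2 * of_nat (Suc i))) *s F (Suc i)"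
      by (simp only: vector_sadd_rdistrib)
    also have "of_nat (Suc i) * (\<mu> - of_nat i) + (\<mu> - 2 * of_nat (Suc i)) =
        of_nat (Suc (Suc i)) * (\<mu> - of_nat (Suc i))"
      by (simp add: algebra_simps)
    finally show ?case .
  qed
  have "F j' \<noteq> 0" "F (Suc j') = 0"
    using j j' by auto
  with eF[of j'] have "\<mu> = of_nat j'"
    by (simp del: of_nat_Suc)
  then have "c = of_nat j' - 2 * of_nat k'"
    unfolding \<mu>_def by (simp only: eq_diff_eq)
  then show ?thesis
    by simp
qed

text \<open>The trace of \<open>h ** h\<close> is the sum of the squares of the eigenvalues of
  \<open>h\<close>. These are real, so all are 0 and \<open>h\<close> is nilpotent; in particular 2
  is not an eigenvalue.\<close>

lemma sl2_trivial_of_trace: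
  fixes h e f :: "complex^'n::finite^'n"
  assumes he: "h ** e - e ** h = cscale 2 e" and hf: "h ** f - f ** h = cscale (- 2) f"
    and ef: "e ** f - f ** e = h" and tr: "trace (h ** h) = 0"
  shows "e = 0" "f = 0"
proof -
  have nil: "mpow h (CARD('n)) = 0"
  proof (rule spectrum[of h])
    fix es :: "'n \<Rightarrow> complex"
    assume es: "\<And>p. trace (mpeval p h) = (\<Sum>i\<in>UNIV. poly p (es i))"
      "\<And>i. \<exists>v. v \<noteq> 0 \<and> h *v v = es i *s v"
      "\<And>p. (\<And>i. poly p (es i) = 0) \<Longrightarrow> mpeval (p ^ CARD('n)) h = 0"
    have "es i \<in> \<real>" for i
      using es(2)[of i] sl2_eigenvalue_real[OF he hf ef] by blast
    then have re: "es i = of_real (Re (es i))" for i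
      by (simp add: complex_is_Real_iff complex_eq_iff)
    have "(\<Sum>i\<in>UNIV. (es i)\<^sup>2) = 0"
      using es(1)[of "[:0, 0, 1:]"] tr by (simp add: power2_eq_square)
    then have "(\<Sum>i\<in>UNIV. of_real ((Re (es i))\<^sup>2) :: complex) = 0"
      by (subst (asm) re) simp
    then have "(\<Sum>i\<in>UNIV. (Re (es i))\<^sup>2) = 0"
      unfolding of_real_sum[symmetric] by (simp only: of_real_eq_0_iff)
    then have "Re (es i) = 0" for i
      by (simp add: sum_nonneg_eq_0_iff)
    then have "es i = 0" for i
      using re[of i] by simp
    then show ?thesis
      using es(3)[of "[:0, 1:]"] by (simp add: mpeval_power)
  qed
  have pow: "mpow h n ** X = cscale (2 ^ n) X" if "h ** X = cscale 2 X" for n X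
    by (induct n) (simp_all add: matrix_mul_assoc[symmetric] cscale_mult that cscale_cscale mult.commute)
  \<comment> \<open>\<open>e ** h ^ (k + 1) = 0\<close> puts the columns of \<open>e ** h ^ k\<close> in the 2-eigenspace of the nilpotent \<open>h\<close>\<close>
  have step: "e ** mpow h k = 0" if "e ** mpow h (Suc k) = 0" for k
  proof -
    have "h ** e = e ** h + cscale 2 e"
      using he by (simp add: algebra_simps)
    then have "h ** (e ** mpow h k) = cscale 2 (e ** mpow h k)"
      using that by (simp add: matrix_mul_assoc matrix_mult_linear(1) cscale_mult)
    from pow[OF this, of "CARD('n)"] show ?thesis
      by (simp add: nil cscale_def vec_eq_iff)
  qed
  \<comment> \<open>Descending induction on the exponent, starting from the vanishing power of
    \<open>h\<close>; beyond \<open>CARD('n)\<close> the truncated subtraction stays at exponent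
    0.\<close>
  have "e ** mpow h (CARD('n) - k) = 0" for k
  proof (induct k)
    case (Suc k)
    then show ?case
      using step[of "CARD('n) - Suc k"]
      by (cases "k < CARD('n)") (simp_all add: Suc_diff_Suc)
  qed (simp add: nil)
  from this[of "CARD('n)"] show "e = 0"
    by simp
  with ef hf show "f = 0"
    by (simp add: cscale_def vec_eq_iff matrix_matrix_mult_def)
qed

section \<open>Sums of matrices and sums over matrix units\<close>

lemma matrix_mult_sum:
  fixes M :: "complex^'k::finite^'l::finite" and N :: "complex^'o::finite^'k"
  shows "sum f S ** N = (\<Sum>x\<in>S. f x ** N)" "M ** sum g S = (\<Sum>x\<in>S. M ** g x)"
  by (induct S rule: infinite_finite_induct)
    (simp_all add: matrix_mult_linear(1) matrix_add_ldistrib)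

lemma trace_sum:
  fixes f :: "'a \<Rightarrow> complex^'n::finite^'n"
  shows "trace (sum f S) = (\<Sum>x\<in>S. trace (f x))"
  by (induct S rule: infinite_finite_induct) (simp_all add: trace_add trace_0[simplified])

lemma sum_UNIV_prod:
  fixes f :: "'a::finite \<times> 'b::finite \<Rightarrow> 'c::comm_monoid_add"
  shows "(\<Sum>p\<in>UNIV. f p) = (\<Sum>i\<in>UNIV. \<Sum>j\<in>UNIV. f (i, j))"
  by (simp add: sum.cartesian_product case_prod_beta)

lemma matrix_vector_mult_axis:
  fixes M :: "complex^'k::finite^'l::finite"
  shows "(M *v axis k 1) $ l = M $ l $ k"
  by (simp add: matrix_vector_mult_def axis_def if_distrib[of "\<lambda>y. _ * y"] cong: if_cong)

text \<open>Invariance of the tensor \<open>\<Sum>\<close> \<open>E_ij \<otimes> E_ji\<close> under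
  the adjoint action of \<open>E_kl\<close>. Here \<open>\<phi> i j k l\<close> stands for a product
  of \<open>E_ij\<close> and \<open>E_kl\<close>, so the identity serves compositions of operators
  as well as nonassociative products.\<close>

lemma gl_invariant_sum:
  fixes \<phi> :: "'m::finite \<Rightarrow> 'm \<Rightarrow> 'm \<Rightarrow> 'm \<Rightarrow> 'v::ab_group_add"
  shows "(\<Sum>i\<in>UNIV. \<Sum>j\<in>UNIV.
     ((if l = i then \<phi> k j j i else 0) - (if j = k then \<phi> i l j i else 0)) +
     ((if l = j then \<phi> i j k i else 0) - (if i = k then \<phi> i j j l else 0))) = 0"
proof -
  have "(\<Sum>i\<in>UNIV. \<Sum>j\<in>UNIV. if l = i then \<phi> k j j i else 0) = (\<Sum>j\<in>UNIV. \<phi> k j j l)"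
    "(\<Sum>i\<in>UNIV. \<Sum>j\<in>UNIV. if i = k then \<phi> i j j l else 0) = (\<Sum>j\<in>UNIV. \<phi> k j j l)"
    by (subst sum.swap, simp)+
  then show ?thesis
    by (simp add: sum.distrib sum_subtractf)
qed

section \<open>The Casimir operator and its generalized kernel\<close>

definition gl_rep :: "('m::finite \<Rightarrow> 'm \<Rightarrow> complex^'n::finite^'n) \<Rightarrow> bool" where
  "gl_rep L \<longleftrightarrow> (\<forall>i j k l. L i j ** L k l - L k l ** L i j =
     (if j = k then L i l else 0) - (if l = i then L k j else 0))"

text \<open>\<open>CARD('m)\<close> times the Casimir operator of the restriction to \<open>sl(m)\<close>.\<close>

definition casimir :: "('m::finite \<Rightarrow> 'm \<Rightarrow> complex^'n::finite^'n) \<Rightarrow> complex^'n^'n" where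
  "casimir L = cscale (of_nat CARD('m)) (\<Sum>i\<in>UNIV. \<Sum>j\<in>UNIV. L i j ** L j i) -
     (\<Sum>i\<in>UNIV. L i i) ** (\<Sum>i\<in>UNIV. L i i)"

text \<open>The sum of the \<open>L i i\<close> is the image of the identity matrix and hence
  central; the quadratic term commutes by the derivation rule and
  \<open>gl_invariant_sum\<close>.\<close>

lemma casimir_commute:
  fixes L :: "'m::finite \<Rightarrow> 'm \<Rightarrow> complex^'n::finite^'n"
  assumes "gl_rep L"
  shows "L k l ** casimir L = casimir L ** L k l"
proof -
  note br = assms[unfolded gl_rep_def, rule_format]
  define I where "I = (\<Sum>i\<in>UNIV. L i i)"
  define Q where "Q = (\<Sum>i\<in>UNIV. \<Sum>j\<in>UNIV. L i j ** L j i)"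
  have "L k l ** I - I ** L k l = (\<Sum>i\<in>UNIV. L k l ** L i i - L i i ** L k l)"
    by (simp add: I_def matrix_mult_sum sum_subtractf)
  also have "\<dots> = 0"
    by (simp add: br sum_subtractf)
  finally have I: "L k l ** I = I ** L k l"
    by simp
  have deriv: "X ** (Y ** Z) - (Y ** Z) ** X = (X ** Y - Y ** X) ** Z + Y ** (X ** Z - Z ** X)"
    for X Y Z :: "complex^'n^'n"
    by (simp add: matrix_mult_linear matrix_mul_assoc)
  have "L k l ** Q - Q ** L k l =
      (\<Sum>i\<in>UNIV. \<Sum>j\<in>UNIV. L k l ** (L i j ** L j i) - (L i j ** L j i) ** L k l)"
    by (simp add: Q_def matrix_mult_sum sum_subtractf)
  also have "\<dots> = (\<Sum>i\<in>UNIV. \<Sum>j\<in>UNIV.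
     ((if l = i then L k j ** L j i else 0) - (if j = k then L i l ** L j i else 0)) +
     ((if l = j then L i j ** L k i else 0) - (if i = k then L i j ** L j l else 0)))"
    unfolding deriv br by (intro sum.cong refl) (auto simp: matrix_mult_linear)
  also have "\<dots> = 0"
    by (rule gl_invariant_sum)
  finally have Q: "L k l ** Q = Q ** L k l"
    by simp
  have "L k l ** (I ** I) = (I ** I) ** L k l"
    by (metis I matrix_mul_assoc)
  with Q show ?thesis
    by (simp add: casimir_def I_def[symmetric] Q_def[symmetric] matrix_mult_linear cscale_mult)
qed

text \<open>The trace form \<open>\<beta>\<close> on the range of \<open>P\<close> is invariant, so
  on sl(m) it is governed by one number \<open>c\<close>. The Casimir trace equals
  \<open>c * (m * (m - 1) * (m + 1))\<close>, whence \<open>c = 0\<close>, and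
  \<open>sl2_trivial_of_trace\<close> applies to the sl(2)-triple of \<open>i\<close> and
  \<open>j\<close> multiplied by \<open>P\<close>.\<close>

lemma casimir_projection:
  fixes L :: "'m::finite \<Rightarrow> 'm \<Rightarrow> complex^'n::finite^'n"
  assumes rep: "gl_rep L" and comm: "\<And>i j. P ** L i j = L i j ** P"
    and idem: "P ** P = P" and tr: "trace (P ** casimir L) = 0" and "i \<noteq> j"
  shows "P ** L i j = 0"
proof -
  note br = rep[unfolded gl_rep_def, rule_format]
  define \<beta> where "\<beta> X Y = trace (P ** X ** Y)" for X Y :: "complex^'n^'n"
  have sym: "\<beta> X (L i j) = \<beta> (L i j) X" for X i j
    unfolding \<beta>_def using trace_mul_sym[of "P ** X" "L i j"]
    by (simp add: matrix_mul_assoc comm)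
  have inv: "\<beta> (X ** L i j - L i j ** X) Z = \<beta> X (L i j ** Z - Z ** L i j)" for X Z i j
  proof -
    have "trace (P ** (L i j ** X) ** Z) = trace (P ** X ** (Z ** L i j))"
      using trace_mul_sym[of "L i j" "P ** X ** Z"]
      by (simp add: matrix_mul_assoc comm)
    then show ?thesis
      by (simp add: \<beta>_def matrix_mult_linear trace_sub matrix_mul_assoc)
  qed
  define \<kappa> where "\<kappa> i j = \<beta> (L i j) (L j i)" for i j
  have \<kappa>_sym: "\<kappa> i j = \<kappa> j i" for i j
    unfolding \<kappa>_def by (rule sym)
  \<comment> \<open>Invariance moves one factor of \<open>E_ij = [E_ik, E_kj]\<close> to the other
    argument, where \<open>[E_kj, E_ji] = E_ki\<close>. Together with symmetry this links all pairs
    of distinct indices.\<close>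
  have \<kappa>_step: "\<kappa> i j = \<kappa> i k" if "i \<noteq> j" "i \<noteq> k" for i j k
  proof (cases "j = k")
    case False
    have "\<kappa> i j = \<beta> (L i k ** L k j - L k j ** L i k) (L j i)"
      using that by (simp add: \<kappa>_def br)
    also have "\<dots> = \<kappa> i k"
      unfolding inv using False that by (simp add: \<kappa>_def br)
    finally show ?thesis .
  qed simp
  define c where "c = \<kappa> i j"
  have \<kappa>: "\<kappa> k l = c" if "k \<noteq> l" for k l
    unfolding c_def using \<kappa>_sym \<kappa>_step \<open>i \<noteq> j\<close> that by metis
  have lin: "\<beta> (X - Y) Z = \<beta> X Z - \<beta> Y Z" "\<beta> Z (X - Y) = \<beta> Z X - \<beta> Z Y" for X Y Z
    by (simp_all add: \<beta>_def matrix_mult_linear trace_sub)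
  have H: "\<beta> (L k k - L l l) (L k k - L l l) = (if k = l then 0 else 2 * c)" for k l
  proof (cases "k = l")
    case True
    then show ?thesis by (simp add: \<beta>_def trace_0[simplified])
  next
    case False
    have "\<beta> (L k k - L l l) (L k k - L l l) = \<beta> (L k l ** L l k - L l k ** L k l) (L k k - L l l)"
      by (simp add: br)
    also have "\<dots> = \<beta> (L k l) (L l k ** (L k k - L l l) - (L k k - L l l) ** L l k)"
      by (rule inv)
    also have "L l k ** (L k k - L l l) - (L k k - L l l) ** L l k =
       (L l k ** L k k - L k k ** L l k) - (L l k ** L l l - L l l ** L l k)"
      by (simp add: matrix_mult_linear)
    also have "\<dots> = L l k - (- L l k)"
      using False by (simp add: br)
    also have "\<beta> (L k l) \<dots> = 2 * c"
      using \<kappa>[OF False] by (simp only: lin) (simp add: \<beta>_def \<kappa>_def matrix_mult_linear trace_def sum_negf)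
    finally show ?thesis
      using False by simp
  qed
  define m :: complex where "m = of_nat CARD('m)"
  define d where "d = (\<Sum>k\<in>UNIV. \<beta> (L k k) (L k k))"
  define g where "g = (\<Sum>k\<in>UNIV. \<Sum>l\<in>UNIV. \<beta> (L k k) (L l l))"
  \<comment> \<open>There are \<open>m\<close> diagonal pairs and \<open>m * m - m\<close>
    others.\<close>
  have off: "(\<Sum>k\<in>UNIV. \<Sum>l\<in>UNIV. if k = l then D k else x) = m * m * x - m * x + sum D UNIV"
    for x :: complex and D :: "'m \<Rightarrow> complex"
  proof -
    have "(if k = l then D k else x) = x + (if k = l then D k - x else 0)" for k l
      by simp
    then show ?thesis
      by (simp only:) (simp add: sum.distrib sum_subtractf m_def)
  qed
  \<comment> \<open>The values of \<open>\<beta>\<close> on the \<open>L k k\<close> involve the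
    center of gl(m), but \<open>m * d - g\<close> depends on \<open>c\<close> alone, and this
    combination is what the Casimir trace contains.\<close>
  have "(\<Sum>k\<in>UNIV. \<Sum>l\<in>UNIV. \<beta> (L k k - L l l) (L k k - L l l)) = 2 * m * d - 2 * g"
  proof -
    have "\<beta> (L k k - L l l) (L k k - L l l) =
       \<beta> (L k k) (L k k) + \<beta> (L l l) (L l l) - 2 * \<beta> (L k k) (L l l)" for k l
      by (simp add: lin sym[of "L l l" k k])
    then show ?thesis
      by (simp add: sum.distrib sum_subtractf sum_distrib_left[symmetric] d_def g_def m_def)
  qed
  then have "2 * (m * d - g) = 2 * (c * (m * m - m))"
    unfolding H off by (simp add: algebra_simps)
  then have g: "m * d - g = c * (m * m - m)"
    by (simp only: mult_cancel_left) simp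
  have "trace (P ** casimir L) = m * (\<Sum>k\<in>UNIV. \<Sum>l\<in>UNIV. \<kappa> k l) - g"
    by (simp add: casimir_def matrix_mult_linear cscale_mult matrix_mult_sum trace_sub trace_cscale
        trace_sum matrix_mul_assoc \<kappa>_def g_def \<beta>_def m_def)
      (rule sum.swap)
  also have "\<dots> = m * (\<Sum>k\<in>UNIV. \<Sum>l\<in>UNIV. if k = l then \<beta> (L k k) (L k k) else c) - g"
    using \<kappa> by (intro arg_cong2[of _ _ _ _ "\<lambda>x y. m * x - y"] sum.cong refl) (simp add: \<kappa>_def)
  also have "\<dots> = c * (m * (m - 1) * (m + 1))"
    unfolding off d_def[symmetric] using g by (simp add: algebra_simps)
  finally have *: "c * (m * (m - 1) * (m + 1)) = 0"
    using tr by simp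
  have "CARD('m) \<ge> 2"
    using card_mono[of UNIV "{i, j}"] \<open>i \<noteq> j\<close> by simp
  then have "m \<noteq> 0" "m - 1 \<noteq> 0"
    by (simp_all add: m_def)
  moreover have "m + 1 = of_nat (Suc CARD('m))"
    by (simp add: m_def)
  then have "m + 1 \<noteq> 0"
    by (simp del: of_nat_Suc)
  ultimately have c: "c = 0"
    using * by simp
  \<comment> \<open>On operators commuting with \<open>P\<close>, multiplication by \<open>P\<close>
    is multiplicative, so it preserves the sl(2) relations.\<close>
  have mult: "(P ** X) ** (P ** Y) = P ** (X ** Y)" if "P ** X = X ** P" for X Y
    by (metis idem matrix_mul_assoc that)
  have commH: "P ** (L i i - L j j) = (L i i - L j j) ** P"
    by (simp add: matrix_mult_linear comm)
  show ?thesis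
  proof (rule sl2_trivial_of_trace(1))
    show "P ** (L i i - L j j) ** (P ** L i j) - P ** L i j ** (P ** (L i i - L j j)) =
        cscale 2 (P ** L i j)"
    proof -
      have "(L i i - L j j) ** L i j - L i j ** (L i i - L j j) =
          (L i i ** L i j - L i j ** L i i) - (L j j ** L i j - L i j ** L j j)"
        by (simp add: matrix_mult_linear)
      also have "\<dots> = cscale 2 (L i j)"
        using \<open>i \<noteq> j\<close> by (simp add: br cscale_def vec_eq_iff)
      finally show ?thesis
        by (simp add: mult[OF commH] mult[OF comm] matrix_mult_linear(3)[symmetric] cscale_mult)
    qed
    show "P ** (L i i - L j j) ** (P ** L j i) - P ** L j i ** (P ** (L i i - L j j)) =
        cscale (- 2) (P ** L j i)"
    proof -
      have "(L i i - L j j) ** L j i - L j i ** (L i i - L j j) =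
          (L i i ** L j i - L j i ** L i i) - (L j j ** L j i - L j i ** L j j)"
        by (simp add: matrix_mult_linear)
      also have "\<dots> = cscale (- 2) (L j i)"
        using \<open>i \<noteq> j\<close> by (simp add: br cscale_def vec_eq_iff)
      finally show ?thesis
        by (simp add: mult[OF commH] mult[OF comm] matrix_mult_linear(3)[symmetric] cscale_mult)
    qed
    show "P ** L i j ** (P ** L j i) - P ** L j i ** (P ** L i j) = P ** (L i i - L j j)"
      by (simp add: mult[OF comm] matrix_mult_linear(3)[symmetric] br)
    show "trace (P ** (L i i - L j j) ** (P ** (L i i - L j j))) = 0"
      using H[of i j] unfolding mult[OF commH] by (simp add: c \<beta>_def matrix_mul_assoc)
  qed
qed

text \<open>\<open>B\<close> limits the nonzero eigenvalues of the Casimir operator to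
  \<open>CARD('k)\<close>, so the projection \<open>P\<close> has rank at least 2. By
  \<open>torsion_free\<close>, \<open>P\<close> kills brackets of off-diagonal units; hence it
  factors through the trace and has rank at most 1.\<close>

lemma no_casimir_with_small_spectrum:
  fixes L :: "'m::finite \<Rightarrow> 'm \<Rightarrow> complex^('m \<times> 'm)^('m \<times> 'm)" and B :: "complex^'k::finite^'k"
  assumes rep: "gl_rep L"
    and torsion_free: "\<And>i j k l. L i j *v axis (k, l) 1 - L k l *v axis (i, j) 1 =
       (if j = k then axis (i, l) 1 else 0) - (if l = i then axis (k, j) 1 else 0)"
    and powers: "\<And>k. trace (mpow (casimir L) (Suc k)) = trace (mpow B (Suc k))"
    and m: "CARD('m) \<ge> 3" and k: "CARD('k) + 2 \<le> CARD('m) * CARD('m)"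
  shows False
proof (rule fitting_projection[OF powers])
  fix f n
  define P where "P = mpeval f (casimir L)"
  assume "mpeval f (casimir L) ** mpeval f (casimir L) = mpeval f (casimir L)"
    and "trace (mpeval f (casimir L) ** casimir L) = 0"
    and "trace (mpeval f (casimir L)) = of_nat CARD('m \<times> 'm) - of_nat CARD('k) + of_nat n"
  then have idem: "P ** P = P" and tr: "trace (P ** casimir L) = 0"
    and trP: "trace P = of_nat (CARD('m) * CARD('m)) - of_nat CARD('k) + of_nat n"
    by (simp_all add: P_def)
  have comm: "P ** L i j = L i j ** P" for i j
    unfolding P_def by (rule mpeval_commute[symmetric]) (rule casimir_commute[OF rep])
  note kill = casimir_projection[OF rep comm idem tr]
  define e :: "'m \<Rightarrow> 'm \<Rightarrow> complex^('m \<times> 'm)" where "e i j = axis (i, j) 1" for i j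
  have bracket: "P *v ((if j = k then e i l else 0) - (if l = i then e k j else 0)) = 0"
    if "i \<noteq> j" "k \<noteq> l" for i j k l
  proof -
    have "P *v (L i j *v e k l - L k l *v e i j) = 0"
      using kill[OF that(1)] kill[OF that(2)]
      by (simp add: matrix_vector_mult_diff_distrib matrix_vector_mul_assoc)
    then show ?thesis
      by (simp only: e_def torsion_free)
  qed
  \<comment> \<open>A third index \<open>k\<close> makes \<open>e i j\<close> the bracket of the
    off-diagonal units \<open>e i k\<close> and \<open>e k j\<close>; this is where \<open>m\<close>
    enters.\<close>
  have off: "P *v e i j = 0" if "i \<noteq> j" for i j
  proof -
    have "\<not> UNIV \<subseteq> {i, j}"
      using m card_mono[of "{i, j}" "UNIV :: 'm set"] card_insert_le_m1[of 2 "{j}" i] by auto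
    then obtain k where "k \<noteq> i" "k \<noteq> j" by auto
    with bracket[of i k k j] that show ?thesis by auto
  qed
  have diag: "P *v e i i = P *v e j j" for i j
    using bracket[of i j j i] by (cases "i = j") (auto simp: matrix_vector_mult_diff_distrib)
  obtain i\<^sub>0 :: 'm where True by simp
  define w where "w = P *v e i\<^sub>0 i\<^sub>0"
  \<comment> \<open>The trace of the matrix whose coordinate vector is \<open>x\<close>.\<close>
  define \<tau> where "\<tau> x = (\<Sum>i\<in>UNIV. x $ (i, i))" for x :: "complex^('m \<times> 'm)"
  have col: "P $ s $ (i, j) = (if i = j then w $ s else 0)" for s i j
  proof -
    have "P $ s $ (i, j) = (P *v e i j) $ s"
      by (simp add: e_def matrix_vector_mult_axis)
    also have "P *v e i j = (if i = j then w else 0)"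
      using off[of i j] diag[of i i\<^sub>0] by (auto simp: w_def)
    finally show ?thesis by simp
  qed
  have Pv: "P *v x = \<tau> x *s w" for x
  proof -
    have "(P *v x) $ s = (\<Sum>i\<in>UNIV. \<Sum>j\<in>UNIV. P $ s $ (i, j) * x $ (i, j))" for s
      by (simp add: matrix_vector_mult_def sum_UNIV_prod)
    also have "(\<Sum>i\<in>UNIV. \<Sum>j\<in>UNIV. P $ s $ (i, j) * x $ (i, j)) = \<tau> x * w $ s" for s
      by (simp add: col \<tau>_def sum_distrib_left if_distrib[of "\<lambda>y. y * _"]
          if_distrib[of "\<lambda>y. _ * y"] mult.commute cong: if_cong)
    finally show ?thesis
      by (simp add: vec_eq_iff)
  qed
  have "trace P = (\<Sum>i\<in>UNIV. \<Sum>j\<in>UNIV. P $ (i, j) $ (i, j))"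
    by (simp add: trace_def sum_UNIV_prod)
  also have "\<dots> = \<tau> w"
    by (simp add: col \<tau>_def)
  finally have "trace P = \<tau> w" .
  \<comment> \<open>Idempotence of a map of the form \<open>\<tau> x *s w\<close> leaves only 0 and
    1 for \<open>\<tau> w\<close>, which is the trace of \<open>P\<close>.\<close>
  moreover have "P *v w = w"
    by (simp add: w_def matrix_vector_mul_assoc idem)
  then have "\<tau> w *s w = w"
    by (simp add: Pv)
  then have "\<tau> w = 1 \<or> \<tau> w = 0"
    by (cases "w = 0") (auto simp: \<tau>_def vec_eq_iff)
  \<comment> \<open>Adding \<open>of_nat CARD('k)\<close> turns the comparison into one of natural
    numbers.\<close>
  ultimately have "trace P + of_nat CARD('k) = of_nat CARD('k) \<or> trace P + of_nat CARD('k) = of_nat (CARD('k) + 1)"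
    by auto
  moreover have "trace P + of_nat CARD('k) = of_nat (CARD('m) * CARD('m) + n)"
    by (simp add: trP)
  ultimately have "CARD('m) * CARD('m) + n = CARD('k) \<or> CARD('m) * CARD('m) + n = CARD('k) + 1"
    by (metis of_nat_eq_iff)
  with k show False
    by linarith
qed

section \<open>Coordinates on \<open>sl(m|1)\<close>\<close>

text \<open>For rectangular factors: odd operators map between the even and the odd part, whose
  dimensions differ.\<close>

lemma trace_mult_commute:
  fixes M :: "complex^'k::finite^'l::finite" and N :: "complex^'l^'k"
  shows "trace (M ** N) = trace (N ** M)"
  by (simp add: trace_def matrix_matrix_mult_def mult.commute) (rule sum.swap)

definition munit :: "'k::finite \<Rightarrow> 'l::finite \<Rightarrow> complex^'l^'k" where
  "munit a b = (\<chi> i j. if i = a \<and> j = b then 1 else 0)"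

lemma munit_mult: "munit a b ** munit c d = (if b = c then munit a d else 0)"
  by (auto simp: munit_def matrix_matrix_mult_def vec_eq_iff if_distrib[of "\<lambda>x. x * _"] sum.delta
      intro!: sum.neutral cong: if_cong)

text \<open>The lower right entry makes the supertrace of the diagonal units vanish. These elements
  realize gl(m) as the even part of sl(m|1).\<close>

definition even_unit :: "'m \<Rightarrow> 'm \<Rightarrow> ('m::finite, 1) supermatrix" where
  "even_unit i j = munit (Inl i) (Inl j) + (if i = j then munit (Inr 1) (Inr 1) else 0)"

definition odd_unit :: "'m + 'm \<Rightarrow> ('m::finite, 1) supermatrix" where
  "odd_unit s = (case s of Inl i \<Rightarrow> munit (Inl i) (Inr 1) | Inr i \<Rightarrow> munit (Inr 1) (Inl i))"

definition even_coords :: "('m::finite, 1) supermatrix \<Rightarrow> complex^('m \<times> 'm)" where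
  "even_coords X = (\<chi> s. X $ Inl (fst s) $ Inl (snd s))"

definition odd_coords :: "('m::finite, 1) supermatrix \<Rightarrow> complex^('m + 'm)" where
  "odd_coords X = (\<chi> s. case s of Inl i \<Rightarrow> X $ Inl i $ Inr 1 | Inr i \<Rightarrow> X $ Inr 1 $ Inl i)"

section \<open>Bases and matrices of linear maps\<close>

text \<open>A common frame for the even and the odd part. \<open>co\<close> is linear on all
  matrices but determines a matrix only inside \<open>S\<close>.\<close>

locale coordinates =
  fixes S :: "(complex^'k::finite^'k) set"
    and b :: "'i::finite \<Rightarrow> complex^'k^'k"
    and co :: "complex^'k^'k \<Rightarrow> complex^'i"
  assumes basis_in: "b i \<in> S"
    and zero_in: "0 \<in> S"
    and add_in: "X \<in> S \<Longrightarrow> Y \<in> S \<Longrightarrow> X + Y \<in> S"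
    and cscale_in: "X \<in> S \<Longrightarrow> cscale c X \<in> S"
    and expansion: "X \<in> S \<Longrightarrow> X = (\<Sum>i\<in>UNIV. cscale (co X $ i) (b i))"
    and co_add: "co (X + Y) = co X + co Y"
    and co_cscale: "co (cscale c X) = c *s co X"
    and co_basis: "co (b i) = axis i 1"
begin

lemma co_zero: "co 0 = 0"
  using co_cscale[of 0 0] by simp

lemma co_diff: "co (X - Y) = co X - co Y"
  using co_add[of "X - Y" Y] by (simp add: algebra_simps)

lemma co_sum: "co (sum f A) = (\<Sum>x\<in>A. co (f x))"
  by (induct A rule: infinite_finite_induct) (simp_all add: co_zero co_add)

lemma sum_in: "(\<And>x. x \<in> A \<Longrightarrow> f x \<in> S) \<Longrightarrow> sum f A \<in> S"
  by (induct A rule: infinite_finite_induct) (simp_all add: zero_in add_in)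

lemma additive_sum:
  fixes F :: "complex^'k^'k \<Rightarrow> 'v::ab_group_add"
  assumes "\<And>X Y. X \<in> S \<Longrightarrow> Y \<in> S \<Longrightarrow> F (X + Y) = F X + F Y" "\<And>x. x \<in> A \<Longrightarrow> f x \<in> S"
  shows "F (sum f A) = (\<Sum>x\<in>A. F (f x))"
proof -
  have F0: "F 0 = 0"
    using assms(1)[OF zero_in zero_in] by simp
  show ?thesis
    using assms(2)
    by (induct A rule: infinite_finite_induct) (simp_all add: F0 assms(1) sum_in)
qed

text \<open>The scaling \<open>sc\<close> is a parameter so that matrix-valued maps and trace
  functionals are both covered.\<close>

lemma linear_expansion:
  fixes F :: "complex^'k^'k \<Rightarrow> 'v::ab_group_add"
  assumes "\<And>X Y. X \<in> S \<Longrightarrow> Y \<in> S \<Longrightarrow> F (X + Y) = F X + F Y"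
    and "\<And>c X. X \<in> S \<Longrightarrow> F (cscale c X) = sc c (F X)" and "X \<in> S"
  shows "F X = (\<Sum>i\<in>UNIV. sc (co X $ i) (F (b i)))"
proof -
  have "F X = F (\<Sum>i\<in>UNIV. cscale (co X $ i) (b i))"
    using expansion[OF \<open>X \<in> S\<close>] by simp
  also have "\<dots> = (\<Sum>i\<in>UNIV. F (cscale (co X $ i) (b i)))"
    by (rule additive_sum) (simp_all add: assms(1) cscale_in basis_in)
  finally show ?thesis
    by (simp add: assms(2) basis_in)
qed

end

text \<open>The matrix of \<open>F\<close> for the basis \<open>b\<close> of the source and the
  coordinates \<open>co\<close> of the target, which may differ in parity.\<close>

definition opmat ::
  "('w \<Rightarrow> complex^'j::finite) \<Rightarrow> ('i::finite \<Rightarrow> 'u) \<Rightarrow> ('u \<Rightarrow> 'w) \<Rightarrow> complex^'i^'j" where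
  "opmat co b F = (\<chi> j i. co (F (b i)) $ j)"

lemma opmat_cong: "(\<And>i. F (b i) = G (b i)) \<Longrightarrow> opmat co b F = opmat co b G"
  by (simp add: opmat_def)

lemma opmat_axis: "opmat co b F *v axis i 1 = co (F (b i))"
  by (simp add: vec_eq_iff matrix_vector_mult_axis) (simp add: opmat_def)

context coordinates begin

lemma opmat_add: "opmat co a (\<lambda>X. F X + G X) = opmat co a F + opmat co a G"
  by (simp add: opmat_def co_add vec_eq_iff)

lemma opmat_diff: "opmat co a (\<lambda>X. F X - G X) = opmat co a F - opmat co a G"
  by (simp add: opmat_def co_diff vec_eq_iff)

lemma opmat_cscale: "opmat co a (\<lambda>X. cscale c (F X)) = cscale c (opmat co a F)"
  by (simp add: opmat_def co_cscale vec_eq_iff) (simp add: cscale_def)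

lemma opmat_zero: "opmat co a (\<lambda>X. 0) = 0"
  by (simp add: opmat_def co_zero vec_eq_iff)

lemma opmat_sum: "opmat co a (\<lambda>X. \<Sum>x\<in>A. F x X) = (\<Sum>x\<in>A. opmat co a (F x))"
  by (induct A rule: infinite_finite_induct) (simp_all add: opmat_zero opmat_add)

lemma opmat_comp:
  assumes other: "coordinates S' b' co'"
    and F: "\<And>X Y. X \<in> S' \<Longrightarrow> Y \<in> S' \<Longrightarrow> F (X + Y) = F X + F Y"
      "\<And>c X. X \<in> S' \<Longrightarrow> F (cscale c X) = cscale c (F X)"
    and G: "\<And>i. G (a i) \<in> S'"
  shows "opmat co a (\<lambda>X. F (G X)) = opmat co b' F ** opmat co' a G"
proof -
  interpret O: coordinates S' b' co' by (rule other)
  have "co (F (G (a i))) $ j = (\<Sum>l\<in>UNIV. co (F (b' l)) $ j * co' (G (a i)) $ l)" for i j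
    using arg_cong[OF O.linear_expansion[of F cscale, OF F G[of i]], of co]
    by (simp add: co_sum co_cscale mult.commute)
  then show ?thesis
    by (simp add: opmat_def matrix_matrix_mult_def vec_eq_iff)
qed

end

section \<open>The even and the odd part of sl(m|1)\<close>

lemma all_sum_num1: "(\<forall>i :: 'm + 1. P i) \<longleftrightarrow> (\<forall>i. P (Inl i)) \<and> P (Inr 1)"
  by (metis num1_eq_iff old.sum.exhaust)

lemma sl_num1_iff: "X \<in> sl \<longleftrightarrow> X $ Inr 1 $ Inr 1 = (\<Sum>i\<in>UNIV. X $ Inl i $ Inl i)"
  for X :: "('m::finite, 1) supermatrix"
  by (auto simp: sl_def trace_def block1_def block4_def)

lemma even_part_iff: "X \<in> sl_part 0 \<longleftrightarrow> X $ Inr 1 $ Inr 1 = (\<Sum>i\<in>UNIV. X $ Inl i $ Inl i) \<and>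
    (\<forall>i. X $ Inl i $ Inr 1 = 0 \<and> X $ Inr 1 $ Inl i = 0)"
  for X :: "('m::finite, 1) supermatrix"
  by (auto simp: sl_part_def sl_num1_iff gl_part_iff all_sum_num1)

lemma odd_part_iff: "X \<in> sl_part 1 \<longleftrightarrow> X $ Inr 1 $ Inr 1 = 0 \<and> (\<forall>i j. X $ Inl i $ Inl j = 0)"
  for X :: "('m::finite, 1) supermatrix"
  by (auto simp: sl_part_def sl_num1_iff gl_part_iff all_sum_num1)

lemma sl_part_closed:
  "0 \<in> sl_part p" "X \<in> sl_part p \<Longrightarrow> Y \<in> sl_part p \<Longrightarrow> X + Y \<in> sl_part p"
  "X \<in> sl_part p \<Longrightarrow> cscale c X \<in> sl_part p"
  by (auto simp: sl_part_def sl_add sl_cscale gl_part_linear gl_part_cscale)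
    (auto simp: sl_iff gl_part_iff)

lemma even_unit_entries:
  "even_unit i j $ Inl p $ Inl q = (if (i, j) = (p, q) then 1 else 0)"
  "even_unit i j $ Inl p $ Inr 1 = 0" "even_unit i j $ Inr 1 $ Inl p = 0"
  "even_unit i j $ Inr 1 $ Inr 1 = (if i = j then 1 else 0)"
  by (auto simp: even_unit_def munit_def)

lemma odd_unit_entries:
  "odd_unit s $ Inl p $ Inl q = 0" "odd_unit s $ Inr 1 $ Inr 1 = 0"
  "odd_unit s $ Inl p $ Inr 1 = (if s = Inl p then 1 else 0)"
  "odd_unit s $ Inr 1 $ Inl p = (if s = Inr p then 1 else 0)"
  by (auto simp: odd_unit_def munit_def split: sum.split)

lemma coordinates_even: "coordinates (sl_part 0) (\<lambda>s. even_unit (fst s) (snd s)) even_coords"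
proof
  fix X :: "('m::finite, 1) supermatrix" and i :: "'m \<times> 'm"
  show "even_unit (fst i) (snd i) \<in> sl_part 0"
    by (auto simp: even_part_iff even_unit_def munit_def)
  show "even_coords (even_unit (fst i) (snd i)) = axis i 1"
    by (auto simp: even_coords_def even_unit_def munit_def axis_def vec_eq_iff prod_eq_iff)
  assume "X \<in> sl_part 0"
  then show "X = (\<Sum>s\<in>UNIV. cscale (even_coords X $ s) (even_unit (fst s) (snd s)))"
    by (auto simp: even_part_iff vec_eq_iff all_sum_num1 even_coords_def cscale_def even_unit_entries
        if_distrib[of "\<lambda>y. _ * y"] sum_UNIV_prod[of "\<lambda>s. if fst s = snd s then _ s else 0"]
        simp flip: prod_eq_iff cong: if_cong)
qed (simp_all add: sl_part_closed, simp_all add: even_coords_def cscale_def vec_eq_iff)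

lemma coordinates_odd: "coordinates (sl_part 1) odd_unit odd_coords"
proof
  fix X :: "('m::finite, 1) supermatrix" and i :: "'m + 'm"
  show "odd_unit i \<in> sl_part 1"
    by (auto simp: odd_part_iff odd_unit_def munit_def split: sum.split)
  show "odd_coords (odd_unit i) = axis i 1"
    by (auto simp: odd_coords_def odd_unit_def munit_def axis_def vec_eq_iff split: sum.split)
  assume "X \<in> sl_part 1"
  then show "X = (\<Sum>s\<in>UNIV. cscale (odd_coords X $ s) (odd_unit s))"
    by (auto simp: odd_part_iff vec_eq_iff all_sum_num1 odd_coords_def cscale_def odd_unit_entries
        if_distrib[of "\<lambda>y. _ * y"] cong: if_cong)
qed (simp_all add: sl_part_closed,
    auto simp: odd_coords_def cscale_def vec_eq_iff split: sum.split)

lemma even_unit_in: "even_unit i j \<in> sl_part 0"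
  using coordinates.basis_in[OF coordinates_even, of "(i, j)"] by simp

lemma odd_unit_in: "odd_unit s \<in> sl_part 1"
  by (rule coordinates.basis_in[OF coordinates_odd])

lemma super_bracket_sl_part:
  "X \<in> sl_part p \<Longrightarrow> Y \<in> sl_part q \<Longrightarrow> super_bracket X Y = X ** Y - cscale (koszul p q) (Y ** X)"
  by (simp add: sl_part_def super_bracket_homogeneous)

section \<open>Brackets of basis elements and traces of the adjoint action\<close>

lemma bracket_even_even:
  "super_bracket (even_unit i j) (even_unit k l) =
    (if j = k then even_unit i l else 0) - (if l = i then even_unit k j else 0)"
  unfolding super_bracket_sl_part[OF even_unit_in even_unit_in]
  by (auto simp: koszul_def even_unit_def matrix_add_ldistrib matrix_mult_linear munit_mult)

lemma bracket_even_odd: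
  "super_bracket (even_unit i j) (odd_unit (Inl k)) =
    (if j = k then odd_unit (Inl i) else 0) - (if i = j then odd_unit (Inl k) else 0)"
  "super_bracket (even_unit i j) (odd_unit (Inr k)) =
    (if i = j then odd_unit (Inr k) else 0) - (if k = i then odd_unit (Inr j) else 0)"
  unfolding super_bracket_sl_part[OF even_unit_in odd_unit_in]
  by (auto simp: koszul_def even_unit_def odd_unit_def matrix_add_ldistrib matrix_mult_linear munit_mult)

text \<open>Every even basis element is thus a bracket of two odd ones, which is the source of the
  supertrace identities.\<close>

lemma bracket_odd_odd:
  "super_bracket (odd_unit (Inl i)) (odd_unit (Inr j)) = even_unit i j"
  unfolding super_bracket_sl_part[OF odd_unit_in odd_unit_in]
  by (auto simp: koszul_def even_unit_def odd_unit_def munit_mult)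

lemma trace_ad_even:
  fixes i j :: "'m::finite"
  shows "trace (opmat even_coords (\<lambda>s. even_unit (fst s) (snd s)) (super_bracket (even_unit i j))) = 0"
proof -
  have "even_coords (super_bracket (even_unit i j) (even_unit k l)) $ (k, l) =
      (if i = k then if j = k then 1 else 0 else 0) - (if l = j then if l = i then 1 else 0 else 0)"
    for k l :: 'm
    by (auto simp: bracket_even_even even_coords_def even_unit_entries)
  then show ?thesis
    by (simp add: trace_def opmat_def sum_UNIV_prod sum_subtractf
        if_distrib[of "\<lambda>y. _ * y"] cong: if_cong)
qed

text \<open>The columns \<open>Inl k\<close> and the rows \<open>Inr k\<close> carry mutually dual
  representations, so their contributions cancel.\<close>

lemma trace_ad_odd:
  fixes i j :: "'m::finite"
  shows "trace (opmat odd_coords odd_unit (super_bracket (even_unit i j))) = 0"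
proof -
  have "odd_coords (super_bracket (even_unit i j) (odd_unit (Inl k))) $ Inl k =
      (if i = k then if j = k then 1 else 0 else 0) - (if i = j then 1 else 0)"
    "odd_coords (super_bracket (even_unit i j) (odd_unit (Inr k))) $ Inr k =
      (if i = j then 1 else 0) - (if i = k then if j = k then 1 else 0 else 0)"
    for k :: 'm
    by (auto simp: bracket_even_odd odd_coords_def odd_unit_entries)
  then show ?thesis
    by (simp add: trace_def opmat_def sum_subtractf flip: UNIV_Plus_UNIV add: sum.Plus)
qed

section \<open>Left-symmetric products on \<open>sl(m|1)\<close>\<close>

locale lssa_on_sl =
  fixes mult :: "('m::finite, 1) supermatrix \<Rightarrow> ('m, 1) supermatrix \<Rightarrow> ('m, 1) supermatrix"
    (infixl "\<diamondop>" 70)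
  assumes lssa: "lssa_on cscale (sl :: ('m, 1) supermatrix set) sl_part super_bracket mult"
begin

interpretation lssa_on cscale "sl :: ('m, 1) supermatrix set" sl_part super_bracket mult
  by (rule lssa)

interpretation even: coordinates "sl_part 0 :: ('m, 1) supermatrix set"
    "\<lambda>s. even_unit (fst s) (snd s)" even_coords
  by (rule coordinates_even)

interpretation odd: coordinates "sl_part 1 :: ('m, 1) supermatrix set" odd_unit odd_coords
  by (rule coordinates_odd)

lemma in_sl: "X \<in> sl_part p \<Longrightarrow> X \<in> sl"
  by (simp add: sl_part_def)

lemma mult_in:
  "X \<in> sl_part 0 \<Longrightarrow> Y \<in> sl_part 0 \<Longrightarrow> X \<diamondop> Y \<in> sl_part 0"
  "X \<in> sl_part 0 \<Longrightarrow> Y \<in> sl_part 1 \<Longrightarrow> X \<diamondop> Y \<in> sl_part 1"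
  "X \<in> sl_part 1 \<Longrightarrow> Y \<in> sl_part 0 \<Longrightarrow> X \<diamondop> Y \<in> sl_part 1"
  "X \<in> sl_part 1 \<Longrightarrow> Y \<in> sl_part 1 \<Longrightarrow> X \<diamondop> Y \<in> sl_part 0"
  using mult_graded[of X 0 Y 0] mult_graded[of X 0 Y 1] mult_graded[of X 1 Y 0]
    mult_graded[of X 1 Y 1] by simp_all

lemma mult_even_in: "X \<in> sl_part 0 \<Longrightarrow> Y \<in> sl_part p \<Longrightarrow> X \<diamondop> Y \<in> sl_part p"
  "X \<in> sl_part 0 \<Longrightarrow> Y \<in> sl_part p \<Longrightarrow> Y \<diamondop> X \<in> sl_part p"
  by (cases p; simp add: mult_in)+

section \<open>Left and right multiplications\<close>

lemma mult_diff_left: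
  assumes "X \<in> sl" "Y \<in> sl" "Z \<in> sl"
  shows "(X - Y) \<diamondop> Z = X \<diamondop> Z - Y \<diamondop> Z"
proof -
  have "X - Y \<in> sl"
    using sl_add[OF assms(1) sl_cscale[OF assms(2), of "-1"]] by simp
  with assms mult_add_left[of "X - Y" Y Z] show ?thesis
    by simp
qed

lemma bracket_even:
  assumes "X \<in> sl_part 0" "Y \<in> sl_part p"
  shows "X \<diamondop> Y - Y \<diamondop> X = super_bracket X Y"
  using supercommutator_eq_bracket[OF assms] by (simp add: koszul_def)

text \<open>Left-symmetry says that left multiplication represents the supercommutator.\<close>

lemma left_mult_bracket_even:
  assumes "X \<in> sl_part 0" "Y \<in> sl_part 0" "Z \<in> sl_part p"
  shows "X \<diamondop> (Y \<diamondop> Z) - Y \<diamondop> (X \<diamondop> Z) = super_bracket X Y \<diamondop> Z"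
proof -
  have "super_bracket X Y \<diamondop> Z = X \<diamondop> Y \<diamondop> Z - Y \<diamondop> X \<diamondop> Z"
    using assms by (simp add: bracket_even[symmetric] mult_diff_left in_sl[of _ 0] in_sl[of Z p] mult_in)
  then show ?thesis
    unfolding \<open>super_bracket X Y \<diamondop> Z = _\<close>
    using left_symmetric[OF assms] by (simp add: koszul_def algebra_simps)
qed

lemma left_mult_bracket_odd:
  assumes "X \<in> sl_part 1" "Y \<in> sl_part 1" "Z \<in> sl_part p"
  shows "X \<diamondop> (Y \<diamondop> Z) + Y \<diamondop> (X \<diamondop> Z) = super_bracket X Y \<diamondop> Z"
proof -
  have "super_bracket X Y \<diamondop> Z = (X \<diamondop> Y + Y \<diamondop> X) \<diamondop> Z"
    using supercommutator_eq_bracket[OF assms(1,2)] by (simp add: koszul_def)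
  also have "\<dots> = X \<diamondop> Y \<diamondop> Z + Y \<diamondop> X \<diamondop> Z"
    using assms by (simp add: mult_add_left in_sl[of _ 0] in_sl[of Z p] mult_in)
  finally show ?thesis
    using left_symmetric[OF assms] by (simp add: koszul_def algebra_simps)
qed

text \<open>Left-symmetry with the element acted upon in the middle; no sign occurs because
  \<open>X\<close> is even.\<close>

lemma left_right_mult:
  assumes "X \<in> sl_part 0" "Y \<in> sl_part 0" "Z \<in> sl_part p"
  shows "X \<diamondop> (Z \<diamondop> Y) - (X \<diamondop> Z) \<diamondop> Y = Z \<diamondop> (X \<diamondop> Y) - (Z \<diamondop> X) \<diamondop> Y"
  using left_symmetric[OF assms(1,3,2)] by (simp add: koszul_def algebra_simps)

lemma left_linear:
  assumes "X \<in> sl"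
  shows "Y \<in> sl_part p \<Longrightarrow> Z \<in> sl_part p \<Longrightarrow> X \<diamondop> (Y + Z) = X \<diamondop> Y + X \<diamondop> Z"
    "Y \<in> sl_part p \<Longrightarrow> X \<diamondop> cscale c Y = cscale c (X \<diamondop> Y)"
  using assms by (simp_all add: mult_add_right mult_scale_right in_sl)

lemma right_linear:
  assumes "X \<in> sl"
  shows "Y \<in> sl_part p \<Longrightarrow> Z \<in> sl_part p \<Longrightarrow> (Y + Z) \<diamondop> X = Y \<diamondop> X + Z \<diamondop> X"
    "Y \<in> sl_part p \<Longrightarrow> cscale c Y \<diamondop> X = cscale c (Y \<diamondop> X)"
  using assms by (simp_all add: mult_add_left mult_scale_left in_sl)

text \<open>Matrix form of \<open>left_right_mult\<close>, for an arbitrary component so that it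
  applies to both parities.\<close>

lemma right_mult_commutator:
  assumes c: "coordinates (sl_part p) b co" and X: "X \<in> sl_part 0" and Y: "Y \<in> sl_part 0"
  defines "L \<equiv> \<lambda>X. opmat co b (\<lambda>Z. X \<diamondop> Z)" and "R \<equiv> \<lambda>X. opmat co b (\<lambda>Z. Z \<diamondop> X)"
  shows "L X ** R Y - R Y ** L X = R (X \<diamondop> Y) - R Y ** R X"
proof -
  interpret c: coordinates "sl_part p" b co by (rule c)
  note in0 = in_sl[OF X] in_sl[OF Y]
  have "opmat co b (\<lambda>Z. X \<diamondop> (Z \<diamondop> Y) - (X \<diamondop> Z) \<diamondop> Y) =
      opmat co b (\<lambda>Z. Z \<diamondop> (X \<diamondop> Y) - (Z \<diamondop> X) \<diamondop> Y)"
    by (rule opmat_cong) (rule left_right_mult[OF X Y c.basis_in])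
  moreover have "opmat co b (\<lambda>Z. X \<diamondop> (Z \<diamondop> Y)) = L X ** R Y"
    unfolding L_def R_def
    by (rule c.opmat_comp[OF c]) (use X Y in0 in \<open>simp_all add: left_linear mult_even_in c.basis_in\<close>)
  moreover have "opmat co b (\<lambda>Z. (X \<diamondop> Z) \<diamondop> Y) = R Y ** L X"
    unfolding L_def R_def
    by (rule c.opmat_comp[OF c]) (use X Y in0 in \<open>simp_all add: right_linear mult_even_in c.basis_in\<close>)
  moreover have "opmat co b (\<lambda>Z. (Z \<diamondop> X) \<diamondop> Y) = R Y ** R X"
    unfolding L_def R_def
    by (rule c.opmat_comp[OF c]) (use X Y in0 in \<open>simp_all add: right_linear mult_even_in c.basis_in\<close>)
  ultimately show ?thesis
    by (simp add: c.opmat_diff R_def)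
qed

section \<open>Supertraces of multiplications\<close>

abbreviation "L0 X \<equiv> opmat even_coords (\<lambda>s. even_unit (fst s) (snd s)) (\<lambda>Z. X \<diamondop> Z)"
abbreviation "R0 X \<equiv> opmat even_coords (\<lambda>s. even_unit (fst s) (snd s)) (\<lambda>Z. Z \<diamondop> X)"
abbreviation "L1 X \<equiv> opmat odd_coords odd_unit (\<lambda>Z. X \<diamondop> Z)"
abbreviation "R1 X \<equiv> opmat odd_coords odd_unit (\<lambda>Z. Z \<diamondop> X)"

text \<open>\<open>even_unit i j\<close> is a bracket of odd elements, so its left multiplication is
  an anticommutator of odd operators. The even and odd blocks contain the same products in opposite
  order, and traces are cyclic.\<close>

lemma supertrace_left_mult: "trace (L0 (even_unit i j)) = trace (L1 (even_unit i j))"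
proof -
  let ?y = "odd_unit (Inl i) :: ('m, 1) supermatrix" and ?w = "odd_unit (Inr j) :: ('m, 1) supermatrix"
  \<comment> \<open>\<open>?A X\<close> leads from the even to the odd part, \<open>?B X\<close>
    back.\<close>
  let ?A = "\<lambda>X. opmat odd_coords (\<lambda>s. even_unit (fst s) (snd s)) (\<lambda>Z. X \<diamondop> Z)"
  let ?B = "\<lambda>X. opmat even_coords odd_unit (\<lambda>Z. X \<diamondop> Z)"
  have y: "?y \<in> sl" "?w \<in> sl"
    by (rule in_sl[OF odd_unit_in])+
  have "L0 (even_unit i j) = opmat even_coords (\<lambda>s. even_unit (fst s) (snd s))
      (\<lambda>Z. ?y \<diamondop> (?w \<diamondop> Z) + ?w \<diamondop> (?y \<diamondop> Z))"
    by (rule opmat_cong)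
      (simp only: left_mult_bracket_odd[OF odd_unit_in odd_unit_in even_unit_in] bracket_odd_odd)
  also have "\<dots> = ?B ?y ** ?A ?w + ?B ?w ** ?A ?y"
    unfolding even.opmat_add
    by (intro arg_cong2[of _ _ _ _ "(+)"]; rule even.opmat_comp[OF coordinates_odd])
      (simp_all add: left_linear[OF y(1)] left_linear[OF y(2)] mult_in odd_unit_in even_unit_in)
  finally have 0: "L0 (even_unit i j) = ?B ?y ** ?A ?w + ?B ?w ** ?A ?y" .
  have "L1 (even_unit i j) = opmat odd_coords odd_unit
      (\<lambda>Z. ?y \<diamondop> (?w \<diamondop> Z) + ?w \<diamondop> (?y \<diamondop> Z))"
    by (rule opmat_cong)
      (simp only: left_mult_bracket_odd[OF odd_unit_in odd_unit_in odd_unit_in] bracket_odd_odd)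
  also have "\<dots> = ?A ?y ** ?B ?w + ?A ?w ** ?B ?y"
    unfolding odd.opmat_add
    by (intro arg_cong2[of _ _ _ _ "(+)"]; rule odd.opmat_comp[OF coordinates_even])
      (simp_all add: left_linear[OF y(1)] left_linear[OF y(2)] mult_in odd_unit_in even_unit_in)
  finally show ?thesis
    using trace_mult_commute[of "?B ?y" "?A ?w"] trace_mult_commute[of "?B ?w" "?A ?y"]
    by (simp add: 0 trace_add)
qed

text \<open>Right multiplication is left multiplication minus the adjoint action, whose traces
  vanish on both parts; linearity extends this from basis elements.\<close>

lemma supertrace_right_mult:
  assumes "X \<in> sl_part 0"
  shows "trace (R0 X) = trace (R1 X)"
proof -
  have "R0 (even_unit i j) = L0 (even_unit i j) -
      opmat even_coords (\<lambda>s. even_unit (fst s) (snd s)) (super_bracket (even_unit i j))" for i j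
    unfolding even.opmat_diff[symmetric]
    by (rule opmat_cong) (simp add: bracket_even[OF even_unit_in even_unit_in, symmetric])
  moreover have "R1 (even_unit i j) = L1 (even_unit i j) -
      opmat odd_coords odd_unit (super_bracket (even_unit i j))" for i j
    unfolding odd.opmat_diff[symmetric]
    by (rule opmat_cong) (simp add: bracket_even[OF even_unit_in odd_unit_in, symmetric])
  ultimately have *: "trace (R0 (even_unit i j)) = trace (R1 (even_unit i j))" for i j
    by (simp add: trace_sub supertrace_left_mult trace_ad_even trace_ad_odd)
  have "trace (R0 X) = (\<Sum>s\<in>UNIV. even_coords X $ s * trace (R0 (even_unit (fst s) (snd s))))"
  proof (rule even.linear_expansion[OF _ _ assms, of "\<lambda>X. trace (R0 X)" "(*)"])
    fix X Y :: "('m, 1) supermatrix" assume "X \<in> sl_part 0" "Y \<in> sl_part 0"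
    then have "R0 (X + Y) = opmat even_coords (\<lambda>s. even_unit (fst s) (snd s)) (\<lambda>Z. Z \<diamondop> X + Z \<diamondop> Y)"
      by (intro opmat_cong) (simp add: mult_add_right in_sl in_sl[OF even_unit_in])
    then show "trace (R0 (X + Y)) = trace (R0 X) + trace (R0 Y)"
      by (simp add: even.opmat_add trace_add)
  next
    fix X :: "('m, 1) supermatrix" and c assume "X \<in> sl_part 0"
    then have "R0 (cscale c X) =
        opmat even_coords (\<lambda>s. even_unit (fst s) (snd s)) (\<lambda>Z. cscale c (Z \<diamondop> X))"
      by (intro opmat_cong) (simp add: mult_scale_right in_sl in_sl[OF even_unit_in])
    then show "trace (R0 (cscale c X)) = c * trace (R0 X)"
      by (simp add: even.opmat_cscale trace_cscale)
  qed
  moreover have "trace (R1 X) = (\<Sum>s\<in>UNIV. even_coords X $ s * trace (R1 (even_unit (fst s) (snd s))))"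
  proof (rule even.linear_expansion[OF _ _ assms, of "\<lambda>X. trace (R1 X)" "(*)"])
    fix X Y :: "('m, 1) supermatrix" assume "X \<in> sl_part 0" "Y \<in> sl_part 0"
    then have "R1 (X + Y) = opmat odd_coords odd_unit (\<lambda>Z. Z \<diamondop> X + Z \<diamondop> Y)"
      by (intro opmat_cong) (simp add: mult_add_right in_sl in_sl[OF odd_unit_in])
    then show "trace (R1 (X + Y)) = trace (R1 X) + trace (R1 Y)"
      by (simp add: odd.opmat_add trace_add)
  next
    fix X :: "('m, 1) supermatrix" and c assume "X \<in> sl_part 0"
    then have "R1 (cscale c X) = opmat odd_coords odd_unit (\<lambda>Z. cscale c (Z \<diamondop> X))"
      by (intro opmat_cong) (simp add: mult_scale_right in_sl in_sl[OF odd_unit_in])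
    then show "trace (R1 (cscale c X)) = c * trace (R1 X)"
      by (simp add: odd.opmat_cscale trace_cscale)
  qed
  ultimately show ?thesis
    by (simp add: *)
qed

text \<open>\<open>X\<close> is arbitrary in the induction because lowering the exponent replaces it
  by \<open>X \<diamondop> Y\<close>; the case \<open>X = Y\<close> gives all positive
  powers.\<close>

lemma supertrace_right_mult_power:
  assumes "Y \<in> sl_part 0" "X \<in> sl_part 0"
  shows "trace (mpow (R0 Y) k ** R0 X) = trace (mpow (R1 Y) k ** R1 X)"
  using assms(2)
proof (induct k arbitrary: X)
  case 0
  then show ?case
    by (simp add: supertrace_right_mult)
next
  case (Suc k)
  \<comment> \<open>Multiplied by \<open>mpow M k\<close>, the commutator of \<open>L\<close> and
    \<open>M\<close> has trace 0, since \<open>M\<close> commutes with its powers.\<close>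
  have step: "trace (mpow M (Suc k) ** N) = trace (mpow M k ** N')"
    if "L ** M - M ** L = N' - M ** N" for L M N N' :: "complex^'l::finite^'l"
  proof -
    have "mpow M k ** (L ** M) - mpow M k ** (M ** L) = mpow M k ** N' - mpow M k ** (M ** N)"
      using arg_cong[OF that, of "\<lambda>Z. mpow M k ** Z"] by (simp only: matrix_mult_linear)
    moreover have "trace (mpow M k ** (L ** M)) = trace (mpow M k ** (M ** L))"
      using trace_mul_sym[of "mpow M k ** L" M] by (simp add: matrix_mul_assoc mpow_commute)
    ultimately have "trace (mpow M k ** N') = trace (mpow M k ** (M ** N))"
      by (metis (no_types, lifting) eq_iff_diff_eq_0 trace_sub)
    then show ?thesis
      by (simp add: matrix_mul_assoc mpow_commute)
  qed
  have "trace (mpow (R0 Y) (Suc k) ** R0 X) = trace (mpow (R0 Y) k ** R0 (X \<diamondop> Y))"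
    by (rule step[OF right_mult_commutator[OF coordinates_even Suc.prems assms(1)]])
  also have "\<dots> = trace (mpow (R1 Y) k ** R1 (X \<diamondop> Y))"
    by (rule Suc.hyps) (simp add: mult_in Suc.prems assms(1))
  also have "\<dots> = trace (mpow (R1 Y) (Suc k) ** R1 X)"
    by (rule step[OF right_mult_commutator[OF coordinates_odd Suc.prems assms(1)], symmetric])
  finally show ?case .
qed

section \<open>The Casimir element and the contradiction\<close>

lemma L0_bracket:
  assumes "X \<in> sl_part 0" "Y \<in> sl_part 0"
  shows "L0 X ** L0 Y - L0 Y ** L0 X = L0 (super_bracket X Y)"
proof -
  note in0 = in_sl[OF assms(1)] in_sl[OF assms(2)]
  have "L0 (super_bracket X Y) = opmat even_coords (\<lambda>s. even_unit (fst s) (snd s))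
      (\<lambda>Z. X \<diamondop> (Y \<diamondop> Z) - Y \<diamondop> (X \<diamondop> Z))"
    by (rule opmat_cong) (simp add: left_mult_bracket_even[OF assms even_unit_in])
  also have "\<dots> = L0 X ** L0 Y - L0 Y ** L0 X"
    unfolding even.opmat_diff
    by (intro arg_cong2[of _ _ _ _ "(-)"]; rule even.opmat_comp[OF coordinates_even])
      (use assms in0 in \<open>simp_all add: left_linear mult_in even_unit_in\<close>)
  finally show ?thesis by simp
qed

lemma gl_rep_left_mult: "gl_rep (\<lambda>i j. L0 (even_unit i j))"
  unfolding gl_rep_def
proof (intro allI)
  fix i j k l :: 'm
  have z: "0 \<diamondop> Z = 0" if "Z \<in> sl" for Z
    using mult_diff_left[OF that that that] by simp
  have "L0 (super_bracket (even_unit i j) (even_unit k l)) =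
    opmat even_coords (\<lambda>s. even_unit (fst s) (snd s))
      (\<lambda>Z. (if j = k then even_unit i l \<diamondop> Z else 0) - (if l = i then even_unit k j \<diamondop> Z else 0))"
    by (rule opmat_cong)
      (simp add: bracket_even_even z mult_diff_left in_sl[OF even_unit_in] in_sl[OF even.zero_in]
        mult_diff_left[of 0, simplified z, simplified])
  then show "L0 (even_unit i j) ** L0 (even_unit k l) - L0 (even_unit k l) ** L0 (even_unit i j) =
      (if j = k then L0 (even_unit i l) else 0) - (if l = i then L0 (even_unit k j) else 0)"
    by (simp add: L0_bracket even_unit_in even.opmat_diff even.opmat_zero)
qed

text \<open>The formula of \<open>casimir\<close> with operators replaced by elements and
  composition by \<open>\<diamondop>\<close>.\<close>

definition casimir_element :: "('m, 1) supermatrix" where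
  "casimir_element = cscale (of_nat CARD('m)) (\<Sum>i\<in>UNIV. \<Sum>j\<in>UNIV. even_unit i j \<diamondop> even_unit j i) -
     (\<Sum>i\<in>UNIV. even_unit i i) \<diamondop> (\<Sum>i\<in>UNIV. even_unit i i)"

text \<open>Moving \<open>z\<close> through a product gives \<open>z \<diamondop> (x \<diamondop> y)
  = x \<diamondop> (y \<diamondop> z)\<close> plus the terms \<open>[z, x] \<diamondop> y\<close>
  and \<open>x \<diamondop> [z, y]\<close>. Summed over the matrix units the extra terms cancel by
  invariance.\<close>

lemma right_mult_casimir_element: "R0 casimir_element = casimir (\<lambda>i j. L0 (even_unit i j))"
proof -
  define I where "I = (\<Sum>i\<in>UNIV. even_unit i i :: ('m, 1) supermatrix)"
  define Q where "Q = (\<Sum>i\<in>UNIV. \<Sum>j\<in>UNIV. even_unit i j \<diamondop> even_unit j i :: ('m, 1) supermatrix)"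
  note e = even_unit_in
  note e_sl = in_sl[OF even_unit_in]
  have I: "I \<in> sl_part 0"
    unfolding I_def by (rule even.sum_in) (rule e)
  have Q: "(\<Sum>j\<in>UNIV. even_unit i j \<diamondop> even_unit j i) \<in> sl_part 0" "Q \<in> sl_part 0" for i :: 'm
    unfolding Q_def by (intro even.sum_in mult_in e)+
  have I_left: "I \<diamondop> Z = (\<Sum>i\<in>UNIV. even_unit i i \<diamondop> Z)" if "Z \<in> sl" for Z
    unfolding I_def by (rule even.additive_sum) (simp_all add: right_linear that e)
  have I_right: "Z \<diamondop> I = (\<Sum>i\<in>UNIV. Z \<diamondop> even_unit i i)" if "Z \<in> sl" for Z
    unfolding I_def by (rule even.additive_sum) (simp_all add: left_linear that e)
  have on_basis: "even_unit k l \<diamondop> casimir_element = cscale (of_nat CARD('m))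
      (\<Sum>i\<in>UNIV. \<Sum>j\<in>UNIV. even_unit i j \<diamondop> (even_unit j i \<diamondop> even_unit k l)) -
      I \<diamondop> (I \<diamondop> even_unit k l)" for k l :: 'm
  proof -
    let ?Z = "even_unit k l :: ('m, 1) supermatrix"
    \<comment> \<open>\<open>I\<close> corresponds to the identity matrix of gl(m), so its bracket
      with \<open>?Z\<close> is 0.\<close>
    have "?Z \<diamondop> I - I \<diamondop> ?Z = (\<Sum>i\<in>UNIV. super_bracket ?Z (even_unit i i))"
      by (simp add: I_left I_right e_sl sum_subtractf[symmetric] bracket_even[OF e e])
    also have "\<dots> = 0"
      by (simp add: bracket_even_even sum_subtractf)
    finally have ZI: "?Z \<diamondop> I = I \<diamondop> ?Z"
      by simp
    have "?Z \<diamondop> (I \<diamondop> I) - I \<diamondop> (?Z \<diamondop> I) = (?Z \<diamondop> I - I \<diamondop> ?Z) \<diamondop> I"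
      by (simp add: left_mult_bracket_even[OF e I I] bracket_even[OF e I])
    also have "\<dots> = 0"
      unfolding ZI using mult_diff_left[OF in_sl[OF I] in_sl[OF I] in_sl[OF I]] by simp
    finally have ZII: "?Z \<diamondop> (I \<diamondop> I) = I \<diamondop> (I \<diamondop> ?Z)"
      by (simp add: ZI)
    have diff_right: "X \<diamondop> (Y - W) = X \<diamondop> Y - X \<diamondop> W" if "X \<in> sl" "Y \<in> sl" "W \<in> sl" for X Y W
    proof -
      have "Y - W \<in> sl"
        using sl_add[OF that(2) sl_cscale[OF that(3), of "-1"]] by simp
      with that mult_add_right[of X "Y - W" W] show ?thesis
        by simp
    qed
    \<comment> \<open>\<open>?Z\<close> passes \<open>even_unit i j\<close> by left-symmetry and
      \<open>even_unit j i\<close> by the commutator; the corrections have the shape of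
      \<open>gl_invariant_sum\<close>.\<close>
    have swap: "?Z \<diamondop> (even_unit i j \<diamondop> even_unit j i) =
        even_unit i j \<diamondop> (even_unit j i \<diamondop> ?Z) +
        (((if l = i then even_unit k j \<diamondop> even_unit j i else 0) -
          (if j = k then even_unit i l \<diamondop> even_unit j i else 0)) +
         ((if l = j then even_unit i j \<diamondop> even_unit k i else 0) -
          (if i = k then even_unit i j \<diamondop> even_unit j l else 0)))" for i j
    proof -
      have z: "X \<diamondop> 0 = 0" "0 \<diamondop> X = 0" if "X \<in> sl" for X
        using diff_right[OF that that that] mult_diff_left[OF that that that] by simp_all
      have "?Z \<diamondop> (even_unit i j \<diamondop> even_unit j i) - even_unit i j \<diamondop> (?Z \<diamondop> even_unit j i) =
          super_bracket ?Z (even_unit i j) \<diamondop> even_unit j i"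
        by (rule left_mult_bracket_even[OF e e e])
      moreover have "even_unit i j \<diamondop> (?Z \<diamondop> even_unit j i) - even_unit i j \<diamondop> (even_unit j i \<diamondop> ?Z) =
          even_unit i j \<diamondop> super_bracket ?Z (even_unit j i)"
        unfolding bracket_even[OF e e, symmetric]
        by (rule diff_right[symmetric]) (simp_all add: e_sl in_sl[OF mult_in(1)] e)
      moreover have "super_bracket ?Z (even_unit i j) \<diamondop> even_unit j i =
          (if l = i then even_unit k j \<diamondop> even_unit j i else 0) -
          (if j = k then even_unit i l \<diamondop> even_unit j i else 0)"
        unfolding bracket_even_even
        by (subst mult_diff_left) (auto simp: e_sl z in_sl[OF even.zero_in])
      moreover have "even_unit i j \<diamondop> super_bracket ?Z (even_unit j i) =
          (if l = j then even_unit i j \<diamondop> even_unit k i else 0) -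
          (if i = k then even_unit i j \<diamondop> even_unit j l else 0)"
        unfolding bracket_even_even
        by (subst diff_right) (auto simp: e_sl z in_sl[OF even.zero_in])
      moreover have "x = z + (p + q)" if "x - y = p" "y - z = q" for x y z p q :: "('m, 1) supermatrix"
        using that by (simp add: algebra_simps)
      ultimately show ?thesis
        by metis
    qed
    have "?Z \<diamondop> Q = (\<Sum>i\<in>UNIV. ?Z \<diamondop> (\<Sum>j\<in>UNIV. even_unit i j \<diamondop> even_unit j i))"
      unfolding Q_def by (rule even.additive_sum) (simp_all add: left_linear[of _ _ 0] e_sl Q)
    also have "\<dots> = (\<Sum>i\<in>UNIV. \<Sum>j\<in>UNIV. ?Z \<diamondop> (even_unit i j \<diamondop> even_unit j i))"
      by (intro sum.cong refl even.additive_sum) (simp_all add: left_linear[of _ _ 0] e_sl e mult_in)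
    also have "\<dots> = (\<Sum>i\<in>UNIV. \<Sum>j\<in>UNIV. even_unit i j \<diamondop> (even_unit j i \<diamondop> ?Z))"
      unfolding swap
      by (subst sum.distrib, subst sum.distrib)
        (simp only: gl_invariant_sum[where \<phi> = "\<lambda>i j k l. even_unit i j \<diamondop> even_unit k l"] add_0_right)
    finally have ZQ: "?Z \<diamondop> Q = (\<Sum>i\<in>UNIV. \<Sum>j\<in>UNIV. even_unit i j \<diamondop> (even_unit j i \<diamondop> ?Z))" .
    have "?Z \<diamondop> casimir_element = cscale (of_nat CARD('m)) (?Z \<diamondop> Q) - ?Z \<diamondop> (I \<diamondop> I)"
      unfolding casimir_element_def I_def[symmetric] Q_def[symmetric]
      by (subst diff_right)
        (simp_all add: mult_scale_right e_sl in_sl[OF Q(2)] sl_cscale in_sl[OF mult_in(1)[OF I I]])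
    then show ?thesis
      by (simp only: ZQ ZII)
  qed
  have L0_I: "L0 I = (\<Sum>i\<in>UNIV. L0 (even_unit i i))"
    unfolding even.opmat_sum[symmetric] by (rule opmat_cong) (simp add: I_left e_sl)
  have comp: "opmat even_coords (\<lambda>s. even_unit (fst s) (snd s)) (\<lambda>Z. X \<diamondop> (Y \<diamondop> Z)) = L0 X ** L0 Y"
    if "X \<in> sl_part 0" "Y \<in> sl_part 0" for X Y
    by (rule even.opmat_comp[OF coordinates_even])
      (use that in_sl[OF that(1)] in \<open>simp_all add: left_linear mult_in e\<close>)
  have "R0 casimir_element = opmat even_coords (\<lambda>s. even_unit (fst s) (snd s)) (\<lambda>Z. cscale (of_nat CARD('m))
      (\<Sum>i\<in>UNIV. \<Sum>j\<in>UNIV. even_unit i j \<diamondop> (even_unit j i \<diamondop> Z)) - I \<diamondop> (I \<diamondop> Z))"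
    by (rule opmat_cong) (rule on_basis)
  then show ?thesis
    by (simp add: even.opmat_diff even.opmat_cscale even.opmat_sum comp e I L0_I casimir_def)
qed

lemma casimir_element_in: "casimir_element \<in> sl_part 0"
proof -
  let ?Q = "\<Sum>i\<in>UNIV. \<Sum>j\<in>UNIV. even_unit i j \<diamondop> even_unit j i :: ('m, 1) supermatrix"
  let ?I = "\<Sum>i\<in>UNIV. even_unit i i :: ('m, 1) supermatrix"
  have I: "?I \<in> sl_part 0"
    by (intro even.sum_in even_unit_in)
  have "?Q \<in> sl_part 0"
    by (intro even.sum_in mult_in even_unit_in)
  then have "cscale (of_nat CARD('m)) ?Q + cscale (- 1) (?I \<diamondop> ?I) \<in> sl_part 0"
    by (intro even.add_in even.cscale_in mult_in I)
  then show ?thesis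
    by (simp add: casimir_element_def)
qed

text \<open>The matrix \<open>B\<close> is right multiplication by the Casimir element on the odd
  part, of dimension \<open>2 * m\<close>.\<close>

lemma rank_less_three:
  shows "CARD('m) < 3"
proof (rule ccontr)
  assume "\<not> CARD('m) < 3"
  then have m: "CARD('m) \<ge> 3"
    by simp
  show False
  proof (rule no_casimir_with_small_spectrum[OF gl_rep_left_mult _ _ m])
    fix i j k l :: 'm
    have "L0 (even_unit i j) *v axis (k, l) 1 - L0 (even_unit k l) *v axis (i, j) 1 =
        even_coords (super_bracket (even_unit i j) (even_unit k l))"
      by (simp add: opmat_axis even.co_diff[symmetric] bracket_even[OF even_unit_in even_unit_in])
    then show "L0 (even_unit i j) *v axis (k, l) 1 - L0 (even_unit k l) *v axis (i, j) 1 =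
        (if j = k then axis (i, l) 1 else 0) - (if l = i then axis (k, j) 1 else 0)"
      using even.co_basis[of "(i, l)"] even.co_basis[of "(k, j)"]
      by (simp add: bracket_even_even even.co_diff even.co_zero)
  next
    fix n
    show "trace (mpow (casimir (\<lambda>i j. L0 (even_unit i j))) (Suc n)) = trace (mpow (R1 casimir_element) (Suc n))"
      using supertrace_right_mult_power[OF casimir_element_in casimir_element_in, of n]
      by (simp add: right_mult_casimir_element mpow_commute)
  next
    \<comment> \<open>For \<open>m \<ge> 3\<close> the square of \<open>m\<close> exceeds
      \<open>2 * m\<close> by at least 3.\<close>
    have "3 * CARD('m) \<le> CARD('m) * CARD('m)"
      using m by (intro mult_right_mono) simp_all
    moreover have "CARD('m + 'm) = CARD('m) + CARD('m)"
      by simp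
    ultimately show "CARD('m + 'm) + 2 \<le> CARD('m) * CARD('m)"
      using m by linarith
  qed
qed

end

theorem theorem1p1:
  assumes "CARD('m::finite) \<ge> 3"
  shows "\<not> (\<exists>mult. lssa_on cscale (sl :: ('m, 1) supermatrix set) sl_part super_bracket mult)"
  using lssa_on_sl.rank_less_three[OF lssa_on_sl.intro] assms by (auto simp: not_less[symmetric])

end
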